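(* Let $m\ge 3$. Then there are exactly two equivalence classes of Niho bent functions on $K=\mathbb{F}_{2^{2m}}$ associated with the hyperconic. Their representatives are the functions $f_1(x)$ and $f_{m-1}(x)$, and the corresponding $g$-function representatives are $$g_1(u)=1\quad (u\in S),\qquad g_{m-1}(u)=\frac{u u^{2}+\bar u\bar u^{2}}{u^{2}+\bar u^{2}}\ \ (u\in S,\ u\neq1),\quad g_{m-1}(1)=1.$$
   Context: $F=\mathbb{F}_{q}$ with $q=2^m$, $n=2m$, $K=\mathbb{F}_{2^n}\supset F$, $\bar{x}=x^q$, $S=\{u\in K: u\bar u=1\}$; $tr$ is the trace from $F$ to $\mathbb{F}_2$ and $Tr$ is the trace from $K$ to $\mathbb{F}_2$. Every $x\in K^*$ is uniquely $x=\lambda u$ with $\lambda\in F^*$, $u\in S$. $K$, a two-dimensional $F$-vector space, is the point set of the affine plane $AG(2,q)$, embedded in its completion $PG(2,q)$, whose points at infinity are the directions $u_\infty$ of the lines $uF$, $u\in S$. The origin is $0\in K$. For $g:S\to F$, if $g(u)=0$ then $u/g(u)$ denotes $u_\infty$. An oval (resp. hyperoval) in $PG(2,q)$ is a set of $q+1$ (resp. $q+2$) points, no three collinear; the tangents of an oval meet in one point, its nucleus, and adding the nucleus gives a hyperoval. Projective equivalence is equivalence under $P\Gamma L(3,q)$. The hyperconic is the hyperoval $\{u\mid u\in S\}\cup\{0\}$ (a conic together with its nucleus). A Boolean function $f:K\to\mathbb{F}_2$ is bent if $\sum_{x\in K}(-1)^{f(x)+Tr(b\bar x)}=\pm 2^m$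 for all $b\in K$. A Niho bent function is a bent function of the form $f(\lambda u)=tr(\lambda g(u))$, $\lambda\in F$, $u\in S$, for some $g:S\to F$; $g$ is called its $g$-function. It is known that such an $f$ is bent if and only if $\{u/g(u)\mid u\in S\}$ is an oval in $PG(2,q)$ with nucleus the origin. A Niho bent function with $g$-function $g$ is associated with a hyperoval $\mathcal{H}$ if the hyperoval $\{u/g(u)\mid u\in S\}\cup\{0\}$ is projectively equivalent to $\mathcal{H}$. Boolean functions $f,f'$ on $K$ are equivalent if $f'=f\circ L+\ell$ for some $\mathbb{F}_2$-affine permutation $L$ of $K$ and some $\mathbb{F}_2$-affine function $\ell:K\to\mathbb{F}_2$; equivalence classes are taken with respect to this relation. Fix $a\in K$ with $a+\bar a=1$. Put $f_1(x)=Tr(ax^{2^m+1})$, and for $1<r<m$ with $\gcd(r,m)=1$ put $$f_r(x)=Tr\Big(ax^{2^m+1}+\sum_{i=1}^{2^{r-1}-1}x^{d_i}\Big),\qquad 2^rd_i\equiv(2^m-1)i+2^r \pmod{2^n-1}.$$ *)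

theory Defs
  imports "HOL-Number_Theory.Cong" "HOL-Library.Product_Plus" "HOL-Library.Cardinality"
begin

text \<open>
  Throughout, the finite field \<open>K\<close> of order \<open>2 ^ (2 * m)\<close> is the universe of a type \<open>'k\<close>;
  its subfields \<open>F\<close> (order \<open>q = 2 ^ m\<close>) and \<open>\<F>\<^sub>2\<close> are subsets of that type.  In particular
  Boolean functions and traces take their values in the prime field \<open>{0, 1}\<close> of \<open>'k\<close>.
\<close>

section \<open>Fields and traces\<close>

definition F2 :: "'k::field set" where
  "F2 = {0, 1}"

definition subF :: "nat \<Rightarrow> 'k::field set" where
  "subF m = {x. x ^ (2 ^ m) = x}"

definition conj_q :: "nat \<Rightarrow> 'k::field \<Rightarrow> 'k" where
  "conj_q m x = x ^ (2 ^ m)"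

definition unit_circle :: "nat \<Rightarrow> 'k::field set" where
  "unit_circle m = {u. u * conj_q m u = 1}"

definition trF :: "nat \<Rightarrow> 'k::field \<Rightarrow> 'k" where
  "trF m x = (\<Sum>i<m. x ^ (2 ^ i))"

definition trK :: "nat \<Rightarrow> 'k::field \<Rightarrow> 'k" where
  "trK m x = (\<Sum>i<2 * m. x ^ (2 ^ i))"

section \<open>The projective plane\<close>

text \<open>
  The completion \<open>PG(2,q)\<close> of the affine plane on the \<open>F\<close>-vector space \<open>K\<close> is the projective plane
  of the three-dimensional \<open>F\<close>-vector space \<open>K \<times> F\<close>: its points are the one-dimensional subspaces,
  the affine point \<open>x \<in> K\<close> is spanned by \<open>(x, 1)\<close>, and the direction of the lines
  parallel to \<open>u F\<close> is spanned by \<open>(u, 0)\<close>.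
\<close>

definition space3 :: "nat \<Rightarrow> ('k::field \<times> 'k) set" where
  "space3 m = UNIV \<times> subF m"

definition smul :: "'k::field \<Rightarrow> 'k \<times> 'k \<Rightarrow> 'k \<times> 'k" where
  "smul c v = (c * fst v, c * snd v)"

definition ppoint :: "nat \<Rightarrow> 'k::field \<times> 'k \<Rightarrow> ('k \<times> 'k) set" where
  "ppoint m v = (\<lambda>c. smul c v) ` subF m"

definition ppoints :: "nat \<Rightarrow> ('k::field \<times> 'k) set set" where
  "ppoints m = ppoint m ` (space3 m - {0})"

definition affine_point :: "nat \<Rightarrow> 'k::field \<Rightarrow> ('k \<times> 'k) set" where
  "affine_point m x = ppoint m (x, 1)"

definition point_at_infinity :: "nat \<Rightarrow> 'k::field \<Rightarrow> ('k \<times> 'k) set" where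
  "point_at_infinity m u = ppoint m (u, 0)"

definition join_line :: "nat \<Rightarrow> ('k::field \<times> 'k) set \<Rightarrow> ('k \<times> 'k) set \<Rightarrow> ('k \<times> 'k) set set" where
  "join_line m P Q = {R \<in> ppoints m. R \<subseteq> {v + w | v w. v \<in> P \<and> w \<in> Q}}"

definition plines :: "nat \<Rightarrow> ('k::field \<times> 'k) set set set" where
  "plines m = {join_line m P Q | P Q. P \<in> ppoints m \<and> Q \<in> ppoints m \<and> P \<noteq> Q}"

definition hyperoval :: "nat \<Rightarrow> ('k::field \<times> 'k) set set \<Rightarrow> bool" where
  "hyperoval m H \<longleftrightarrow>
     H \<subseteq> ppoints m \<and> card H = 2 ^ m + 2 \<and>
     (\<forall>P\<in>H. \<forall>Q\<in>H. \<forall>R\<in>H. P \<noteq> Q \<and> Q \<noteq> R \<and> P \<noteq> R \<longrightarrow>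
        \<not> (\<exists>l\<in>plines m. P \<in> l \<and> Q \<in> l \<and> R \<in> l))"

definition subF_automorphism :: "nat \<Rightarrow> ('k::field \<Rightarrow> 'k) \<Rightarrow> bool" where
  "subF_automorphism m \<sigma> \<longleftrightarrow>
     bij_betw \<sigma> (subF m) (subF m) \<and>
     (\<forall>x\<in>subF m. \<forall>y\<in>subF m. \<sigma> (x + y) = \<sigma> x + \<sigma> y \<and> \<sigma> (x * y) = \<sigma> x * \<sigma> y)"

definition semilinear_bij :: "nat \<Rightarrow> ('k::field \<times> 'k \<Rightarrow> 'k \<times> 'k) \<Rightarrow> bool" where
  "semilinear_bij m \<phi> \<longleftrightarrow>
     bij_betw \<phi> (space3 m) (space3 m) \<and>
     (\<forall>v\<in>space3 m. \<forall>w\<in>space3 m. \<phi> (v + w) = \<phi> v + \<phi> w) \<and>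
     (\<exists>\<sigma>. subF_automorphism m \<sigma> \<and>
        (\<forall>c\<in>subF m. \<forall>v\<in>space3 m. \<phi> (smul c v) = smul (\<sigma> c) (\<phi> v)))"

text \<open>Equivalence under \<open>P\<Gamma>L(3,q)\<close>: a semilinear bijection acts on points by taking images.\<close>

definition proj_equivalent ::
    "nat \<Rightarrow> ('k::field \<times> 'k) set set \<Rightarrow> ('k \<times> 'k) set set \<Rightarrow> bool" where
  "proj_equivalent m H H' \<longleftrightarrow> (\<exists>\<phi>. semilinear_bij m \<phi> \<and> (\<lambda>P. \<phi> ` P) ` H = H')"

definition hyperconic :: "nat \<Rightarrow> ('k::field \<times> 'k) set set" where
  "hyperconic m = affine_point m ` unit_circle m \<union> {affine_point m 0}"

section \<open>Niho bent functions\<close>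

definition boolean_fun :: "('k::field \<Rightarrow> 'k) \<Rightarrow> bool" where
  "boolean_fun f \<longleftrightarrow> range f \<subseteq> F2"

text \<open>\<open>(-1)\<^sup>y\<close> for \<open>y\<close> in the prime field.\<close>

definition sign_F2 :: "'k::field \<Rightarrow> int" where
  "sign_F2 y = (if y = 0 then 1 else - 1)"

definition bent :: "nat \<Rightarrow> ('k::{field,finite} \<Rightarrow> 'k) \<Rightarrow> bool" where
  "bent m f \<longleftrightarrow> boolean_fun f \<and>
     (\<forall>b. (\<Sum>x\<in>UNIV. sign_F2 (f x + trK m (b * conj_q m x))) \<in> {2 ^ m, - (2 ^ m)})"

text \<open>Only the values of \<open>g\<close> on the unit circle matter; the others are unconstrained.\<close>

definition is_g_function :: "nat \<Rightarrow> ('k::field \<Rightarrow> 'k) \<Rightarrow> ('k \<Rightarrow> 'k) \<Rightarrow> bool" where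
  "is_g_function m f g \<longleftrightarrow>
     (\<forall>u\<in>unit_circle m. g u \<in> subF m) \<and>
     (\<forall>l\<in>subF m. \<forall>u\<in>unit_circle m. f (l * u) = trF m (l * g u))"

definition niho_bent :: "nat \<Rightarrow> ('k::{field,finite} \<Rightarrow> 'k) \<Rightarrow> bool" where
  "niho_bent m f \<longleftrightarrow> bent m f \<and> (\<exists>g. is_g_function m f g)"

definition g_point :: "nat \<Rightarrow> ('k::field \<Rightarrow> 'k) \<Rightarrow> 'k \<Rightarrow> ('k \<times> 'k) set" where
  "g_point m g u = (if g u = 0 then point_at_infinity m u else affine_point m (u / g u))"

definition g_hyperoval :: "nat \<Rightarrow> ('k::field \<Rightarrow> 'k) \<Rightarrow> ('k \<times> 'k) set set" where
  "g_hyperoval m g = g_point m g ` unit_circle m \<union> {affine_point m 0}"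

definition associated_with ::
    "nat \<Rightarrow> ('k::field \<Rightarrow> 'k) \<Rightarrow> ('k \<times> 'k) set set \<Rightarrow> bool" where
  "associated_with m f H \<longleftrightarrow>
     (\<exists>g. is_g_function m f g \<and> hyperoval m (g_hyperoval m g) \<and>
          proj_equivalent m (g_hyperoval m g) H)"

definition niho_bent_assoc :: "nat \<Rightarrow> ('k::{field,finite} \<times> 'k) set set \<Rightarrow> ('k \<Rightarrow> 'k) set" where
  "niho_bent_assoc m H = {f. niho_bent m f \<and> associated_with m f H}"

section \<open>Equivalence of Boolean functions\<close>

definition F2_linear :: "('k::field \<Rightarrow> 'k) \<Rightarrow> bool" where
  "F2_linear A \<longleftrightarrow>
     (\<forall>x y. A (x + y) = A x + A y) \<and> (\<forall>c\<in>F2. \<forall>x. A (c * x) = c * A x)"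

definition F2_affine :: "('k::field \<Rightarrow> 'k) \<Rightarrow> bool" where
  "F2_affine L \<longleftrightarrow> (\<exists>A c. F2_linear A \<and> (\<forall>x. L x = A x + c))"

definition boolean_equiv :: "(('k::field \<Rightarrow> 'k) \<times> ('k \<Rightarrow> 'k)) set" where
  "boolean_equiv = {(f, f'). boolean_fun f \<and> boolean_fun f' \<and>
     (\<exists>L l. F2_affine L \<and> bij L \<and> F2_affine l \<and> boolean_fun l \<and>
            f' = (\<lambda>x. f (L x) + l x))}"

section \<open>The functions \<open>f\<^sub>r\<close>\<close>

definition f_one :: "nat \<Rightarrow> 'k::field \<Rightarrow> 'k \<Rightarrow> 'k" where
  "f_one m a x = trK m (a * x ^ (2 ^ m + 1))"

text \<open>
  The exponents are determined modulo \<open>2 ^ (2 * m) - 1\<close> only.  None of them is \<open>0\<close> modulo that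
  number when \<open>m \<ge> 2\<close> (modulo \<open>2 ^ m - 1\<close> the congruence says \<open>d i \<equiv> 1\<close>), so for every choice of
  natural representatives the powers \<open>x ^ d i\<close> are the same functions on \<open>K\<close>, also at \<open>x = 0\<close>.
\<close>

definition niho_exponents :: "nat \<Rightarrow> nat \<Rightarrow> (nat \<Rightarrow> nat) \<Rightarrow> bool" where
  "niho_exponents m r d \<longleftrightarrow>
     (\<forall>i\<in>{1..2 ^ (r - 1) - 1}.
        [2 ^ r * d i = (2 ^ m - 1) * i + 2 ^ r] (mod (2 ^ (2 * m) - 1)))"

definition f_niho :: "nat \<Rightarrow> nat \<Rightarrow> (nat \<Rightarrow> nat) \<Rightarrow> 'k::field \<Rightarrow> 'k \<Rightarrow> 'k" where
  "f_niho m r d a x =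
     trK m (a * x ^ (2 ^ m + 1) + (\<Sum>i = 1..2 ^ (r - 1) - 1. x ^ d i))"

definition g_last :: "nat \<Rightarrow> 'k::field \<Rightarrow> 'k" where
  "g_last m u =
     (if u = 1 then 1
      else (u * u ^ 2 + conj_q m u * (conj_q m u) ^ 2) / (u ^ 2 + (conj_q m u) ^ 2))"

end

theory Submission
  imports Defs "HOL-Computational_Algebra.Polynomial"
begin

text \<open>
  A point of \<open>PG(2,q)\<close> is spanned by a vector \<open>(x, z)\<close>, and the hyperoval of a g-function \<open>g\<close> is spanned
  by the vectors \<open>(u, g u)\<close> together with the origin \<open>(0, 1)\<close>. A semilinear map that fixes the origin
  and takes one such hyperoval to another yields an equivalence of the Niho bent functions.
  Hence the class of a function associated with the hyperconic depends only on where the collineation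
  onto the hyperconic sends the origin: to the nucleus or, after a rotation, to the point \<open>1\<close>.
  The first case is \<open>f\<^sub>1\<close>, the second \<open>f\<^sub>m\<^sub>-\<^sub>1\<close>. They differ because
  \<open>f\<^sub>1(x) = tr(N x)\<close> is quadratic whereas \<open>f\<^sub>m\<^sub>-\<^sub>1(x) = tr(T x + N x / T x)\<close> off \<open>F\<close>, with
  \<open>T x = x + x\<^sup>q\<close> and \<open>N x = x x\<^sup>q\<close>, has nonzero third differences.
\<close>

text \<open>Bentness and the hyperoval property are both read off from one count: how many
  \<open>u\<close> in \<open>S\<close> satisfy \<open>g u = T (b * cj u)\<close>, for each
  \<open>b\<close>. For both g-functions this reduces to a quadratic
  \<open>cj c * v^2 + e * v + c = 0\<close> on the unit circle, whose symmetry under conjugation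
  pairs its roots. The obstacle is inequivalence. Boolean equivalence admits arbitrary F2-affine
  permutations, which need not respect the F-structure, so two different positions of the origin do
  not by themselves separate the functions. Third differences do, since they detect degree above two
  under every affine substitution. Their vanishing would force \<open>t ^ 4 = t\<close> for every
  \<open>t\<close> in \<open>F\<close>, which is impossible for \<open>q > 4\<close>; here
  \<open>m \<ge> 3\<close> is decisive.\<close>

section \<open>Polynomial roots, finite fields and F2-affine maps\<close>

lemma card_roots_le:
  fixes p :: "'a::idom poly"
  assumes "p \<noteq> 0" and "\<And>x. x \<in> A \<Longrightarrow> poly p x = 0"
  shows "card A \<le> degree p"
proof -
  have "card A \<le> card {x. poly p x = 0}"
    by (rule card_mono) (use assms poly_roots_finite in auto)
  also have "\<dots> \<le> degree p"
    by (rule card_poly_roots_bound) fact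
  finally show ?thesis .
qed

lemma power_card_eq_same:
  fixes x :: "'a::{field,finite}"
  shows "x ^ CARD('a) = x"
proof (cases "x = 0")
  case False
  have "x * (\<Prod>y\<in>UNIV-{0}. x * y) = x * x ^ (CARD('a) - 1) * \<Prod>(UNIV-{0})"
    by (simp add: prod.distrib mult_ac)
  also have "x * x ^ (CARD('a) - 1) = x ^ Suc (CARD('a) - 1)"
    by (subst power_Suc) auto
  also have "Suc (CARD('a) - 1) = CARD('a)"
    using finite_UNIV_card_ge_0[where ?'a = 'a] by simp
  also have "(\<Prod>y\<in>UNIV-{0}. x * y) = (\<Prod>y\<in>UNIV-{0}. y)"
    by (rule prod.reindex_bij_witness[of _ "\<lambda>y. y / x" "\<lambda>y. x * y"]) (use False in auto)
  finally show ?thesis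
    by simp
qed (use finite_UNIV_card_ge_0[where ?'a = 'a] in auto)

lemma F2_affine_additive:
  fixes A :: "'a::field \<Rightarrow> 'a"
  assumes "\<And>x y. A (x + y) = A x + A y"
  shows "F2_affine A"
proof -
  have "A 0 + A 0 = A 0 + 0" using assms[of 0 0] by simp
  hence "A 0 = 0" by (simp only: add_left_cancel)
  hence "F2_linear A" using assms by (simp add: F2_linear_def F2_def)
  thus ?thesis unfolding F2_affine_def by (intro exI[of _ A] exI[of _ 0]) simp
qed

text \<open>Homogeneity over the scalars 0 and 1 adds nothing to additivity, so affinity is a single
  identity without existentials, the form in which composition, inversion and sums are
  handled.\<close>

lemma F2_affine_iff:
  fixes L :: "'a::field \<Rightarrow> 'a"
  shows "F2_affine L \<longleftrightarrow> (\<forall>x y. L (x + y) = L x + L y - L 0)"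
proof
  assume "F2_affine L"
  then obtain A c where L: "\<And>x. L x = A x + c" and A: "\<And>x y. A (x + y) = A x + A y"
    unfolding F2_affine_def F2_linear_def by blast
  have "A 0 + A 0 = A 0 + 0" using A[of 0 0] by simp
  hence "A 0 = 0" by (simp only: add_left_cancel)
  thus "\<forall>x y. L (x + y) = L x + L y - L 0" by (simp add: L A)
next
  assume L: "\<forall>x y. L (x + y) = L x + L y - L 0"
  define A where "A x = L x - L 0" for x
  have A: "A (x + y) = A x + A y" for x y using L by (simp add: A_def)
  have "A 0 = 0" by (simp add: A_def)
  hence "F2_linear A" using A by (simp add: F2_linear_def F2_def)
  thus "F2_affine L"
    unfolding F2_affine_def by (intro exI[of _ A] exI[of _ "L 0"]) (simp add: A_def)
qed

lemma F2_affine_diff: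
  fixes L :: "'a::field \<Rightarrow> 'a"
  assumes "F2_affine L"
  shows "L (x + y - z) = L x + L y - L z"
proof -
  have L: "L (x + y) = L x + L y - L 0" for x y using assms F2_affine_iff by blast
  have "L (x + y) = L (x + y - z) + L z - L 0" using L[of "x + y - z" z] by simp
  thus ?thesis using L[of x y] by (simp add: algebra_simps)
qed

lemma F2_affine_comp:
  fixes L M :: "'a::field \<Rightarrow> 'a"
  assumes "F2_affine L" "F2_affine M"
  shows "F2_affine (\<lambda>x. L (M x))"
  using assms(2) F2_affine_diff[OF assms(1)] unfolding F2_affine_iff[of M]
  by (simp add: F2_affine_iff)

lemma F2_affine_inv:
  fixes L :: "'a::field \<Rightarrow> 'a"
  assumes "F2_affine L" "bij L"
  shows "F2_affine (inv L)"
  unfolding F2_affine_iff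
proof (intro allI)
  fix x y
  have L: "L (inv L z) = z" for z using assms(2) by (simp add: bij_is_surj surj_f_inv_f)
  have "L (inv L x + inv L y - inv L 0) = x + y"
    by (simp add: F2_affine_diff[OF assms(1)] L)
  thus "inv L (x + y) = inv L x + inv L y - inv L 0"
    using assms(2) by (metis bij_inv_eq_iff)
qed

lemma F2_affine_add:
  fixes L M :: "'a::field \<Rightarrow> 'a"
  shows "F2_affine L \<Longrightarrow> F2_affine M \<Longrightarrow> F2_affine (\<lambda>x. L x + M x)"
  by (simp add: F2_affine_iff)

section \<open>The field and its subfield\<close>

locale niho_field =
  fixes m :: nat and type :: "'k::{field,finite} itself"
  assumes m_ge: "m \<ge> 3" and card_K: "CARD('k) = 2 ^ (2 * m)"
begin

abbreviation cj :: "'k \<Rightarrow> 'k" where "cj \<equiv> conj_q m"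
abbreviation F :: "'k set" where "F \<equiv> subF m"
abbreviation S :: "'k set" where "S \<equiv> unit_circle m"
abbreviation T :: "'k \<Rightarrow> 'k" where "T x \<equiv> x + cj x"
abbreviation N :: "'k \<Rightarrow> 'k" where "N x \<equiv> x * cj x"
abbreviation tr :: "'k \<Rightarrow> 'k" where "tr \<equiv> trF m"

text \<open>Translation by 1 permutes the field, so summing all elements in two ways gives
  \<open>CARD('k) = 0\<close> in \<open>'k\<close>, and the cardinality is a power of two.\<close>

lemma two_eq_0: "(2::'k) = 0"
proof -
  have "(\<Sum>y\<in>(UNIV::'k set). y) = (\<Sum>y\<in>(UNIV::'k set). y + 1)"
    by (rule sum.reindex_bij_witness[of _ "\<lambda>y. y + 1" "\<lambda>y. y - 1"]) auto
  hence "of_nat CARD('k) = (0::'k)"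
    by (simp add: sum.distrib)
  thus ?thesis
    by (simp add: card_K)
qed

lemma char2 [simp]: "(x::'k) + x = 0"
  by (metis mult_2 mult_zero_left two_eq_0)

lemma char2_left [simp]: "(x::'k) + (x + y) = y"
  by (simp add: add.assoc [symmetric])

lemma uminus_char2 [simp]: "- (x::'k) = x"
  by (metis add_eq_0_iff char2)

lemma minus_char2 [simp]: "(x::'k) - y = x + y"
  by (metis diff_conv_add_uminus uminus_char2)

lemma add_eq_0_char2: "(x::'k) + y = 0 \<longleftrightarrow> x = y"
  by (metis add_eq_0_iff uminus_char2)

lemma frob_add: "((x::'k) + y) ^ (2 ^ j) = x ^ (2 ^ j) + y ^ (2 ^ j)"
proof (induction j arbitrary: x y)
  case (Suc j)
  have "(x + y) ^ 2 = x ^ 2 + y ^ 2"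
    by (simp add: power2_eq_square algebra_simps)
  then show ?case
    by (simp add: power_mult Suc)
qed simp

lemma sq_add: "((x::'k) + y)\<^sup>2 = x\<^sup>2 + y\<^sup>2"
  using frob_add[of x y 1] by simp

lemma frob_inj: "(x::'k) ^ (2 ^ j) = y ^ (2 ^ j) \<longleftrightarrow> x = y"
proof
  assume "x ^ (2 ^ j) = y ^ (2 ^ j)"
  hence "(x + y) ^ (2 ^ j) = 0" by (simp add: frob_add)
  thus "x = y" by (simp add: add_eq_0_char2)
qed simp

lemma sq_inj: "(x::'k)\<^sup>2 = y\<^sup>2 \<longleftrightarrow> x = y"
  using frob_inj[of x 1 y] by simp

lemma frob_sum: "(\<Sum>i\<in>A. f i :: 'k) ^ (2 ^ j) = (\<Sum>i\<in>A. f i ^ (2 ^ j))"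
  by (induction A rule: infinite_finite_induct) (auto simp: frob_add power_0_left)

lemma cj_add: "cj (x + y) = cj x + cj y"
  by (simp add: conj_q_def frob_add)

lemma cj_mult: "cj (x * y) = cj x * cj y"
  by (simp add: conj_q_def power_mult_distrib)

lemma cj_0: "cj 0 = 0" and cj_1: "cj 1 = 1"
  by (simp_all add: conj_q_def power_0_left)

lemma cj_power: "cj (x ^ j) = cj x ^ j"
  by (simp add: conj_q_def flip: power_mult) (simp add: mult.commute)

lemma cj_inverse: "cj (inverse x) = inverse (cj x)"
  by (simp add: conj_q_def power_inverse)

lemma cj_divide: "cj (x / y) = cj x / cj y"
  by (simp add: conj_q_def power_divide)

lemma cj_sum: "cj (\<Sum>i\<in>A. f i) = (\<Sum>i\<in>A. cj (f i))"
  by (simp add: conj_q_def frob_sum)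

lemma cj_cj: "cj (cj x) = x"
proof -
  have "cj (cj x) = x ^ CARD('k)"
    by (simp add: conj_q_def card_K mult_2 flip: power_mult power_add)
  thus ?thesis by (simp add: power_card_eq_same)
qed

lemma cj_eq_0: "cj x = 0 \<longleftrightarrow> x = 0"
  by (simp add: conj_q_def)

lemmas cj_simps = cj_add cj_mult cj_0 cj_1 cj_cj cj_inverse cj_divide cj_power

lemma F_iff: "x \<in> F \<longleftrightarrow> cj x = x"
  by (simp add: subF_def conj_q_def)

lemma F_cj: "x \<in> F \<Longrightarrow> cj x = x"
  by (simp add: F_iff)

lemma F_0: "0 \<in> F" and F_1: "1 \<in> F"
  by (simp_all add: F_iff cj_simps)

lemma F_add: "x \<in> F \<Longrightarrow> y \<in> F \<Longrightarrow> x + y \<in> F"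
  and F_mult: "x \<in> F \<Longrightarrow> y \<in> F \<Longrightarrow> x * y \<in> F"
  and F_divide: "x \<in> F \<Longrightarrow> y \<in> F \<Longrightarrow> x / y \<in> F"
  and F_inverse: "x \<in> F \<Longrightarrow> inverse x \<in> F"
  and F_power: "x \<in> F \<Longrightarrow> x ^ j \<in> F"
  by (simp_all add: F_iff cj_simps)

lemma F_T: "T x \<in> F" and F_N: "N x \<in> F"
  by (simp_all add: F_iff cj_simps add.commute mult.commute)

lemmas F_closed = F_0 F_1 F_add F_mult F_divide F_inverse F_power F_T F_N

lemma T_add: "T (x + y) = T x + T y"
  by (simp add: cj_simps ac_simps)

lemma T_scale: "c \<in> F \<Longrightarrow> T (c * x) = c * T x"
  by (simp add: cj_simps F_cj algebra_simps)

lemma T_F: "c \<in> F \<Longrightarrow> T c = 0"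
  by (simp add: F_cj)

lemma F_sqrt: "x \<in> F \<Longrightarrow> \<exists>y\<in>F. y\<^sup>2 = x"
proof -
  assume x: "x \<in> F"
  have "m = Suc (m - 1)" using m_ge by simp
  hence "(x ^ (2 ^ (m - 1)))\<^sup>2 = x ^ (2 ^ m)"
    by (metis power_Suc2 power_mult)
  with x show ?thesis
    by (intro bexI[of _ "x ^ (2 ^ (m - 1))"] F_power) (auto simp: subF_def)
qed

lemma q_ge_8: "(2::nat) ^ m \<ge> 8"
  using power_increasing[OF m_ge, of "2::nat"] by simp

text \<open>The roots of \<open>X ^ q - X\<close> bound \<open>F\<close> from above. From below:
  \<open>T\<close> maps \<open>K\<close> into \<open>F\<close> and each nonempty fibre is a
  translate of its kernel \<open>F\<close>, so \<open>q^2\<close> is at most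
  \<open>(card F)^2\<close>.\<close>

lemma card_F: "card F = 2 ^ m"
proof (rule antisym)
  let ?p = "monom 1 (2 ^ m) - monom 1 1 :: 'k poly"
  have q: "(2::nat) ^ m > 1" using q_ge_8 by simp
  have "coeff ?p (2 ^ m) = 1"
    using q by (simp add: coeff_monom del: minus_char2)
  hence "?p \<noteq> 0" by (metis coeff_0 zero_neq_one)
  hence "card F \<le> degree ?p"
    by (rule card_roots_le) (simp add: poly_monom subF_def)
  also have "degree ?p \<le> 2 ^ m"
    by (intro degree_diff_le order_trans[OF degree_monom_le]) auto
  finally show "card F \<le> 2 ^ m" .
  have fib: "card (T -` {c}) \<le> card F" for c
  proof (cases "T -` {c} = {}")
    case False
    then obtain x0 where x0: "T x0 = c" by auto
    have "(\<lambda>x. x + x0) ` (T -` {c}) \<subseteq> F"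
    proof safe
      fix x assume "c = T x"
      hence "T (x + x0) = 0" using x0 unfolding T_add by simp
      thus "x + x0 \<in> F" by (simp add: F_iff add_eq_0_char2)
    qed
    thus ?thesis
      by (intro card_inj_on_le[of "\<lambda>x. x + x0"]) (auto simp: inj_on_def)
  qed simp
  have "(UNIV::'k set) = (\<Union>c\<in>F. T -` {c})" using F_T by auto
  hence "CARD('k) \<le> (\<Sum>c\<in>F. card (T -` {c}))"
    by (metis card_UN_le finite)
  also have "\<dots> \<le> (\<Sum>c\<in>F. card F)" by (intro sum_mono fib)
  also have "\<dots> = (card F)\<^sup>2" by (simp add: power2_eq_square)
  finally have "(2 ^ m)\<^sup>2 \<le> (card F)\<^sup>2"
    by (simp add: card_K mult.commute flip: power_mult)
  thus "2 ^ m \<le> card F" by simp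
qed

section \<open>The unit circle and polar coordinates\<close>

lemma S_iff: "u \<in> S \<longleftrightarrow> N u = 1"
  by (simp add: unit_circle_def)

lemma S_cj: "u \<in> S \<Longrightarrow> cj u = inverse u"
  by (metis S_iff inverse_unique)

lemma S_nz: "u \<in> S \<Longrightarrow> u \<noteq> 0"
  by (auto simp: S_iff cj_simps)

lemma S_1: "1 \<in> S"
  by (simp add: S_iff cj_simps)

lemma S_divide: "u \<in> S \<Longrightarrow> v \<in> S \<Longrightarrow> u / v \<in> S"
  and S_power: "u \<in> S \<Longrightarrow> u ^ j \<in> S"
  using S_nz[of u] S_nz[of v] by (simp_all add: S_iff cj_simps S_cj field_simps)

text \<open>For \<open>c\<close> in \<open>F\<close> the norm is \<open>c^2\<close>, and 1 has only
  one square root in characteristic 2. This makes polar coordinates unique.\<close>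

lemma FS_1: assumes "c \<in> F" "c \<in> S" shows "c = 1"
proof -
  have "c\<^sup>2 = 1\<^sup>2" using assms by (simp add: S_iff F_iff power2_eq_square)
  thus ?thesis using sq_inj by blast
qed

lemma S_F_collinear:
  assumes "u \<in> S" "v \<in> S" "c \<in> F" "u = c * v"
  shows "u = v"
  using FS_1[OF \<open>c \<in> F\<close>] assms S_divide[of u v] S_nz[of v] by (simp add: field_simps)

lemma S_T_0: assumes "u \<in> S" shows "T u = 0 \<longleftrightarrow> u = 1"
proof
  assume "T u = 0"
  hence "u \<in> F" by (simp add: F_iff add_eq_0_char2)
  thus "u = 1" using FS_1 assms by blast
qed (simp add: cj_simps)

lemma polar:
  fixes x :: 'k
  obtains l u where "l \<in> F" "u \<in> S" "x = l * u" "l\<^sup>2 = N x"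
proof (cases "x = 0")
  case True
  thus ?thesis using that[of 0 1] F_0 S_1 by simp
next
  case False
  obtain l where l: "l \<in> F" "l\<^sup>2 = N x" using F_sqrt[OF F_N] by blast
  have "l \<noteq> 0" using l False by (auto simp: cj_eq_0)
  moreover from this have "x / l \<in> S"
    using l False by (simp add: S_iff cj_simps F_cj power2_eq_square cj_eq_0)
  ultimately show ?thesis using that[of l "x / l"] l by simp
qed

lemma bij_polar: "bij_betw (\<lambda>(l, u). l * u) ((F - {0}) \<times> S) (UNIV - {0})"
  unfolding bij_betw_def
proof
  show "inj_on (\<lambda>(l, u). l * u) ((F - {0}) \<times> S)"
  proof (rule inj_onI)
    fix p p' assume "p \<in> (F - {0}) \<times> S" "p' \<in> (F - {0}) \<times> S"
      and "(\<lambda>(l, u). l * u) p = (\<lambda>(l, u). l * u) p'"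
    then obtain l u l' u' where p: "p = (l, u)" "p' = (l', u')"
      and a: "l \<in> F" "u \<in> S" "l' \<in> F" "u' \<in> S" "l \<noteq> 0" "l' \<noteq> 0" "l * u = l' * u'"
      by auto
    have "u = (l' / l) * u'" using a by (simp add: field_simps)
    hence "u = u'" using S_F_collinear a F_divide by blast
    with a p S_nz show "p = p'" by auto
  qed
  show "(\<lambda>(l, u). l * u) ` ((F - {0}) \<times> S) = UNIV - {0}"
  proof (intro equalityI subsetI)
    fix x :: 'k assume "x \<in> UNIV - {0}"
    moreover obtain l u where "l \<in> F" "u \<in> S" "x = l * u" by (rule polar)
    ultimately show "x \<in> (\<lambda>(l, u). l * u) ` ((F - {0}) \<times> S)" by force
  qed (use S_nz in auto)
qed

lemma card_S: "card S = 2 ^ m + 1"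
proof -
  define q :: nat where "q = 2 ^ m"
  have "(q - 1) * card S = q * q - 1"
    using bij_betw_same_card[OF bij_polar]
    by (simp add: card_cartesian_product card_Diff_singleton F_0 card_F card_K q_def mult_2 power_add)
  also have "\<dots> = (q - 1) * (q + 1)" by (simp add: algebra_simps)
  finally have "card S = q + 1" using q_ge_8 unfolding q_def by (subst (asm) mult_cancel1) auto
  thus ?thesis by (simp add: q_def)
qed

section \<open>Traces and character sums\<close>

lemma tr_add: "tr (x + y) = tr x + tr y"
  by (simp add: trF_def frob_add sum.distrib)

lemma tr_0: "tr 0 = 0"
  by (simp add: trF_def power_0_left)

lemma tr_sq:
  assumes "x \<in> F"
  shows "tr (x\<^sup>2) = tr x" and "(tr x)\<^sup>2 = tr x"
proof -
  have m: "m > 0" using m_ge by simp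
  have "tr (x\<^sup>2) = (\<Sum>i<m. x ^ (2 ^ Suc i))"
    by (simp add: trF_def flip: power_mult)
  also have "\<dots> + x ^ (2 ^ 0) = tr x + x ^ (2 ^ m)"
    unfolding trF_def using sum.lessThan_Suc_shift[of "\<lambda>i. x ^ (2 ^ i)" m] by (simp add: add.commute)
  finally show "tr (x\<^sup>2) = tr x"
    using assms by (simp add: subF_def)
  moreover have "(tr x)\<^sup>2 = tr (x\<^sup>2)"
    using frob_sum[of "\<lambda>i. x ^ (2 ^ i)" "{..<m}" 1]
    by (simp add: trF_def mult.commute flip: power_mult)
  ultimately show "(tr x)\<^sup>2 = tr x" by simp
qed

lemma tr_01: "x \<in> F \<Longrightarrow> tr x = 0 \<or> tr x = 1"
  using tr_sq(2)[of x] by (simp add: power2_eq_square)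

text \<open>The trace is a polynomial of degree at most \<open>2 ^ (m - 1)\<close> with linear
  coefficient 1, so it cannot vanish on all \<open>2 ^ m\<close> elements of
  \<open>F\<close>.\<close>

lemma tr_surj: "\<exists>x\<in>F. tr x = 1"
proof (rule ccontr)
  assume "\<not> ?thesis"
  hence z: "\<And>x. x \<in> F \<Longrightarrow> tr x = 0" using tr_01 by blast
  let ?p = "\<Sum>i<m. monom 1 (2 ^ i) :: 'k poly"
  have "coeff ?p 1 = (\<Sum>i<m. if i = 0 then 1 else 0)"
    unfolding coeff_sum by (rule sum.cong) auto
  also have "\<dots> = 1" using m_ge by simp
  finally have "?p \<noteq> 0" by (metis coeff_0 zero_neq_one)
  hence "card F \<le> degree ?p"
    by (rule card_roots_le) (use z in \<open>simp add: poly_sum poly_monom trF_def\<close>)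
  also have "degree ?p \<le> 2 ^ (m - 1)"
    by (intro degree_sum_le order_trans[OF degree_monom_le]) auto
  also have "\<dots> < 2 ^ m" using m_ge by simp
  finally show False by (simp add: card_F)
qed

lemma tr_nondegenerate:
  assumes "\<And>l. l \<in> F \<Longrightarrow> tr (l * c) = 0" "c \<in> F"
  shows "c = 0"
proof (rule ccontr)
  assume "c \<noteq> 0"
  obtain x where "x \<in> F" "tr x = 1" using tr_surj by blast
  with assms(1)[of "x / c"] \<open>c \<noteq> 0\<close> F_divide assms(2) show False by simp
qed

lemma trK_eq: "trK m x = tr (T x)"
proof -
  have "trK m x = (\<Sum>i<m. x ^ (2 ^ i)) + (\<Sum>i=m..<m + m. x ^ (2 ^ i))"
    unfolding trK_def mult_2 lessThan_atLeast0
    by (rule sum.atLeastLessThan_concat [symmetric]) auto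
  also have "(\<Sum>i=m..<m + m. x ^ (2 ^ i)) = (\<Sum>i<m. cj x ^ (2 ^ i))"
    using sum.shift_bounds_nat_ivl[of "\<lambda>i. x ^ (2 ^ i)" 0 m m]
    by (simp add: conj_q_def lessThan_atLeast0 power_add mult.commute flip: power_mult)
  finally show ?thesis unfolding tr_add by (simp only: trF_def)
qed

text \<open>Translation by some \<open>l0\<close> with \<open>tr (l0 * c) = 1\<close> flips every
  sign, so for \<open>c \<noteq> 0\<close> the sum equals its own negative.\<close>

lemma sum_sign_tr:
  assumes "c \<in> F"
  shows "(\<Sum>l\<in>F. sign_F2 (tr (l * c))) = (if c = 0 then 2 ^ m else 0)"
proof (cases "c = 0")
  case True
  thus ?thesis by (simp add: tr_0 sign_F2_def card_F)
next
  case False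
  obtain l0 where l0: "l0 \<in> F" "tr (l0 * c) = 1"
    using tr_nondegenerate[of c] assms False tr_01[OF F_mult] by blast
  have "(\<Sum>l\<in>F. sign_F2 (tr (l * c))) = (\<Sum>l\<in>F. sign_F2 (tr ((l + l0) * c)))"
    by (rule sum.reindex_bij_witness[of _ "\<lambda>l. l + l0" "\<lambda>l. l + l0"])
      (use l0 in \<open>auto simp: F_add add.assoc\<close>)
  also have "\<dots> = (\<Sum>l\<in>F. - sign_F2 (tr (l * c)))"
  proof (rule sum.cong)
    fix l assume "l \<in> F"
    hence "tr (l * c) = 0 \<or> tr (l * c) = 1" using assms by (intro tr_01 F_mult)
    thus "sign_F2 (tr ((l + l0) * c)) = - sign_F2 (tr (l * c))"
      by (auto simp: distrib_right tr_add l0 sign_F2_def)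
  qed simp
  finally show ?thesis using False by (simp add: sum_negf)
qed

section \<open>Bentness and hyperovals\<close>

text \<open>The equations \<open>z = T (b * cj x)\<close> describe the lines missing the origin, so
  each of these meets the points spanned by the vectors \<open>(u, g u)\<close> in 0 or 2
  points.\<close>

definition oval_function :: "('k \<Rightarrow> 'k) \<Rightarrow> bool" where
  "oval_function g \<longleftrightarrow>
     (\<forall>u\<in>S. g u \<in> F) \<and> (\<forall>b. card {u \<in> S. g u = T (b * cj u)} \<in> {0, 2})"

lemma boolean_fun_niho:
  fixes f :: "'k \<Rightarrow> 'k"
  assumes "is_g_function m f g"
  shows "boolean_fun f"
  unfolding boolean_fun_def F2_def
proof safe
  fix x :: 'k assume "f x \<notin> {}" "f x \<noteq> 0"
  obtain l u where "l \<in> F" "u \<in> S" "x = l * u" by (rule polar)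
  with assms have "f x = tr (l * g u)" "l * g u \<in> F"
    by (auto simp: is_g_function_def F_mult)
  with tr_01 \<open>f x \<noteq> 0\<close> show "f x = 1" by auto
qed

text \<open>The Walsh coefficient at \<open>b\<close> is \<open>2 ^ m * (card ?A - 1)\<close>: on
  each ray \<open>F u\<close> the exponent is the trace of a multiple of \<open>l\<close>, so the
  ray contributes a full character sum.\<close>

lemma bent_niho:
  assumes f: "is_g_function m f g" and g: "oval_function g"
  shows "bent m f"
  unfolding bent_def
proof (intro conjI allI)
  show "boolean_fun f" using f by (rule boolean_fun_niho)
  fix b
  let ?s = "\<lambda>x. sign_F2 (f x + trK m (b * cj x))"
  let ?A = "{u \<in> S. g u = T (b * cj u)}"
  have gF: "g u + T (b * cj u) \<in> F" if "u \<in> S" for u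
    using f that by (intro F_add[OF _ F_T]) (auto simp: is_g_function_def)
  have s: "?s (l * u) = sign_F2 (tr (l * (g u + T (b * cj u))))" if "l \<in> F" "u \<in> S" for l u
  proof -
    have "T (b * cj (l * u)) = l * T (b * cj u)"
      using that by (simp add: cj_simps F_cj algebra_simps)
    with f that show ?thesis
      by (simp add: is_g_function_def trK_eq tr_add distrib_left)
  qed
  have 0: "?s 0 = 1"
    using s[of 0 1] F_0 S_1 by (simp add: tr_0 sign_F2_def)
  have "(\<Sum>x\<in>UNIV. ?s x) = ?s 0 + (\<Sum>x\<in>UNIV - {0}. ?s x)"
    by (rule sum.remove) auto
  also have "(\<Sum>x\<in>UNIV - {0}. ?s x) = (\<Sum>(l, u)\<in>(F - {0}) \<times> S. ?s (l * u))"
    using sum.reindex_bij_betw[OF bij_polar, of ?s] by (simp add: case_prod_unfold)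
  also have "\<dots> = (\<Sum>u\<in>S. \<Sum>l\<in>F - {0}. ?s (l * u))"
    by (subst sum.swap) (simp add: sum.cartesian_product)
  \<comment> \<open>The \<open>- 1\<close> removes \<open>l = 0\<close> from each character sum;
    over all rays this costs \<open>2 ^ m + 1\<close>, and the single term at \<open>x = 0\<close>
    gives one back.\<close>
  also have "\<dots> = (\<Sum>u\<in>S. (if g u = T (b * cj u) then 2 ^ m else 0) - 1)"
  proof (rule sum.cong)
    fix u assume u: "u \<in> S"
    have "(\<Sum>l\<in>F. ?s (l * u)) = (\<Sum>l\<in>F. sign_F2 (tr (l * (g u + T (b * cj u)))))"
      using s u by (intro sum.cong) auto
    also have "\<dots> = (if g u = T (b * cj u) then 2 ^ m else 0)"
      using sum_sign_tr[OF gF[OF u]] by (simp add: add_eq_0_char2 del: add.assoc)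
    also have "(\<Sum>l\<in>F. ?s (l * u)) = ?s (0 * u) + (\<Sum>l\<in>F - {0}. ?s (l * u))"
      by (rule sum.remove) (auto simp: F_0)
    finally show "(\<Sum>l\<in>F - {0}. ?s (l * u)) = (if g u = T (b * cj u) then 2 ^ m else 0) - 1"
      using 0 by simp
  qed simp
  also have "\<dots> = 2 ^ m * int (card ?A) - (2 ^ m + 1)"
  proof -
    have "(\<Sum>u\<in>S. if g u = T (b * cj u) then (2::int) ^ m else 0) = (\<Sum>u\<in>?A. 2 ^ m)"
      by (rule sum.inter_filter [symmetric]) simp
    thus ?thesis
      by (simp add: sum_subtractf card_S mult.commute)
  qed
  finally have "(\<Sum>x\<in>UNIV. ?s x) = 2 ^ m * int (card ?A) - 2 ^ m"
    using 0 by simp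
  moreover have "card ?A = 0 \<or> card ?A = 2"
    using g unfolding oval_function_def by blast
  ultimately show "(\<Sum>x\<in>UNIV. ?s x) \<in> {2 ^ m, - (2 ^ m)}"
    by auto
qed

section \<open>Spanning vectors and collinearity\<close>

lemma in_ppoint_self: "v \<in> ppoint m (v :: 'k \<times> 'k)"
  unfolding ppoint_def by (rule image_eqI[of _ _ 1]) (auto simp: smul_def F_1)

lemma ppoint_eqD: "ppoint m v = ppoint m w \<Longrightarrow> \<exists>c\<in>F. v = smul c w"
  using in_ppoint_self[of v] by (auto simp: ppoint_def)

lemma ppoint_smul:
  assumes "c \<in> F" "c \<noteq> 0"
  shows "ppoint m (smul c v) = ppoint m v"
proof (intro equalityI subsetI)
  fix x assume "x \<in> ppoint m (smul c v)"
  then obtain e where "e \<in> F" "x = smul e (smul c v)" by (auto simp: ppoint_def)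
  hence "x = smul (e * c) v" "e * c \<in> F" using assms by (auto simp: smul_def F_mult)
  thus "x \<in> ppoint m v" by (auto simp: ppoint_def)
next
  fix x assume "x \<in> ppoint m v"
  then obtain e where "e \<in> F" "x = smul e v" by (auto simp: ppoint_def)
  hence "x = smul (e / c) (smul c v)" "e / c \<in> F" using assms by (auto simp: smul_def F_divide)
  thus "x \<in> ppoint m (smul c v)" by (auto simp: ppoint_def)
qed

lemma g_point_eq:
  assumes "u \<in> S" "g u \<in> F"
  shows "g_point m g u = ppoint m (u, g u)"
proof (cases "g u = 0")
  case False
  hence "smul (g u) (u / g u, 1) = (u, g u)" by (simp add: smul_def)
  thus ?thesis using False ppoint_smul[OF assms(2) False, of "(u / g u, 1)"]
    by (simp add: g_point_def affine_point_def)
qed (simp add: g_point_def point_at_infinity_def)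

text \<open>One spanning vector per point. Writing \<open>(u, g u)\<close> instead of
  \<open>u / g u\<close> covers the points at infinity, where \<open>g u = 0\<close>, without a case
  distinction.\<close>

definition cone :: "('k \<Rightarrow> 'k) \<Rightarrow> ('k \<times> 'k) set" where
  "cone g = insert (0, 1) ((\<lambda>u. (u, g u)) ` S)"

lemma g_hyperoval_eq:
  assumes "\<forall>u\<in>S. g u \<in> F"
  shows "g_hyperoval m g = ppoint m ` cone g"
  unfolding g_hyperoval_def cone_def image_insert image_image
  using assms by (simp add: g_point_eq affine_point_def Un_commute)

lemma hyperconic_eq: "hyperconic m = g_hyperoval m (\<lambda>u::'k. 1)"
  by (simp add: hyperconic_def g_hyperoval_def g_point_def)

lemma cone_space3: "\<forall>u\<in>S. g u \<in> F \<Longrightarrow> v \<in> cone g \<Longrightarrow> v \<in> space3 m - {0}"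
  using S_nz F_1 by (auto simp: cone_def space3_def zero_prod_def)

lemma cone_smul_eq:
  assumes "v \<in> cone g" "w \<in> cone g" "c \<in> F" "v = smul c w"
  shows "v = w"
proof (cases "fst w = 0")
  case True
  hence "fst v = 0" using assms(4) by (simp add: smul_def)
  with True assms(1,2) show ?thesis using S_nz by (auto simp: cone_def)
next
  case False
  then obtain u where u: "u \<in> S" "w = (u, g u)" using assms(2) by (auto simp: cone_def)
  have "c \<noteq> 0" using assms(1,4) S_nz[of 0] by (auto simp: cone_def smul_def)
  hence "fst v \<noteq> 0" using False assms(4) by (simp add: smul_def)
  then obtain u' where u': "u' \<in> S" "v = (u', g u')" using assms(1) by (auto simp: cone_def)
  have "u' = c * u" using assms(4) u u' by (simp add: smul_def)
  hence "u' = u" using S_F_collinear u u' assms(3) by blast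
  thus ?thesis using u u' by simp
qed

lemma inj_on_ppoint_cone: "inj_on (ppoint m) (cone g)"
  using ppoint_eqD cone_smul_eq by (meson inj_onI)

lemma card_g_hyperoval:
  assumes "\<forall>u\<in>S. g u \<in> F"
  shows "card (g_hyperoval m g) = 2 ^ m + 2"
proof -
  have "card ((\<lambda>u. (u, g u)) ` S) = card S"
    by (rule card_image) (auto simp: inj_on_def)
  moreover have "(0, 1) \<notin> (\<lambda>u. (u, g u)) ` S" using S_nz by auto
  ultimately show ?thesis
    unfolding g_hyperoval_eq[OF assms] card_image[OF inj_on_ppoint_cone]
    by (simp add: cone_def card_S)
qed

text \<open>The form \<open>T (x * cj y)\<close> is alternating on the two-dimensional F-space
  \<open>K\<close> and serves as the 2 x 2 minor; this is the 3 x 3 determinant expanded along the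
  last coordinate, up to a fixed factor.\<close>

definition det3 :: "'k \<times> 'k \<Rightarrow> 'k \<times> 'k \<Rightarrow> 'k \<times> 'k \<Rightarrow> 'k" where
  "det3 p q r = snd p * T (fst q * cj (fst r)) + snd q * T (fst p * cj (fst r))
     + snd r * T (fst p * cj (fst q))"

lemma T_cross_span:
  assumes "c \<in> F" "d \<in> F" "c' \<in> F" "d' \<in> F"
  shows "T ((c * v + d * w) * cj (c' * v + d' * w)) = (c * d' + c' * d) * T (v * cj w)"
  using assms by (simp add: cj_simps F_cj distrib_left distrib_right ac_simps)

lemma det3_collinear:
  assumes "l \<in> plines m" "ppoint m p \<in> l" "ppoint m q \<in> l" "ppoint m r \<in> l"
  shows "det3 p q r = 0"
proof -
  obtain P Q where "P \<in> ppoints m" "Q \<in> ppoints m" and l: "l = join_line m P Q"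
    using assms(1) by (auto simp: plines_def)
  then obtain v w where "P = ppoint m v" "Q = ppoint m w" by (auto simp: ppoints_def)
  hence span: "\<exists>c\<in>F. \<exists>d\<in>F. x = smul c v + smul d w" if "ppoint m x \<in> l" for x
    using that in_ppoint_self[of x] unfolding l join_line_def ppoint_def by blast
  obtain c1 d1 where "c1 \<in> F" "d1 \<in> F" "p = smul c1 v + smul d1 w"
    using span[OF assms(2)] by blast
  moreover obtain c2 d2 where "c2 \<in> F" "d2 \<in> F" "q = smul c2 v + smul d2 w"
    using span[OF assms(3)] by blast
  moreover obtain c3 d3 where "c3 \<in> F" "d3 \<in> F" "r = smul c3 v + smul d3 w"
    using span[OF assms(4)] by blast
  ultimately show ?thesis
    by (simp add: det3_def smul_def T_cross_span)
      (simp add: distrib_left distrib_right ac_simps)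
qed

lemma T_cross_eq_0:
  assumes "u \<in> S" "v \<in> S"
  shows "T (u * cj v) = 0 \<longleftrightarrow> u = v"
proof -
  have "u * cj v = u / v" using S_cj[OF assms(2)] by (simp add: divide_inverse)
  thus ?thesis using S_T_0[OF S_divide[OF assms]] S_nz[OF assms(2)] by simp
qed

text \<open>
  Two points off the origin determine the line \<open>z = T (b x\<^sup>q)\<close> joining them;
  a vanishing determinant puts the third point on it as well.
\<close>

lemma det3_cone:
  assumes g: "oval_function g"
    and pqr: "p \<in> cone g" "q \<in> cone g" "r \<in> cone g" "p \<noteq> q" "q \<noteq> r" "p \<noteq> r"
  shows "det3 p q r \<noteq> 0"
proof
  assume det: "det3 p q r = 0"
  show False
  \<comment> \<open>If the origin is among the three, only the minor of the other two vectors
    survives, and it vanishes only when they agree.\<close>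
  proof (cases "(0, 1) \<in> {p, q, r}")
    case True
    with pqr det show False
      unfolding cone_def det3_def
      by (auto simp: cj_0 T_cross_eq_0)
  next
    case False
    with pqr obtain u v w where uvw: "u \<in> S" "v \<in> S" "w \<in> S"
      and eqs: "p = (u, g u)" "q = (v, g v)" "r = (w, g w)"
      by (auto simp: cone_def)
    have neq: "u \<noteq> v" "v \<noteq> w" "u \<noteq> w" using pqr eqs by auto
    define D where "D = T (u * cj v)"
    \<comment> \<open>Cramer's rule for the line through \<open>(u, g u)\<close> and
      \<open>(v, g v)\<close>, with determinant \<open>D\<close>.\<close>
    define b where "b = (g u * v + g v * u) / D"
    have D: "D \<noteq> 0" "cj D = D"
      using T_cross_eq_0 uvw neq F_T[of "u * cj v"] by (auto simp: D_def F_iff)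
    have gF: "cj (g u) = g u" "cj (g v) = g v"
      using g uvw by (auto simp: oval_function_def F_iff)
    have Tb: "D * T (b * cj x) = g u * T (v * cj x) + g v * T (u * cj x)" for x
    proof -
      have "D * T (b * cj x) = T ((D * b) * cj x)"
        using D by (simp add: cj_simps algebra_simps)
      also have "D * b = g u * v + g v * u"
        using D by (simp add: b_def)
      finally show ?thesis
        by (simp add: cj_simps gF algebra_simps)
    qed
    have "D * T (b * cj u) = D * g u"
      unfolding Tb by (simp add: D_def cj_simps algebra_simps)
    moreover have "D * T (b * cj v) = D * g v"
      unfolding Tb by (simp add: D_def cj_simps algebra_simps)
    moreover have "D * T (b * cj w) = D * g w"
    proof -
      have "g u * T (v * cj w) + g v * T (u * cj w) + D * g w = 0"
        using det by (simp add: det3_def eqs D_def mult.commute)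
      thus ?thesis unfolding Tb by (simp only: add_eq_0_char2)
    qed
    ultimately have "{u, v, w} \<subseteq> {u \<in> S. g u = T (b * cj u)}"
      using D uvw by auto
    hence "card {u, v, w} \<le> card {u \<in> S. g u = T (b * cj u)}"
      by (intro card_mono) auto
    moreover have "card {u \<in> S. g u = T (b * cj u)} \<le> 2"
    proof -
      have "card {u \<in> S. g u = T (b * cj u)} = 0 \<or> card {u \<in> S. g u = T (b * cj u)} = 2"
        using g unfolding oval_function_def by blast
      thus ?thesis by (elim disjE) (simp_all only:)
    qed
    ultimately show False using neq by simp
  qed
qed

lemma hyperoval_oval_function:
  assumes "oval_function g"
  shows "hyperoval m (g_hyperoval m g)"
proof -
  have gF: "\<forall>u\<in>S. g u \<in> F" using assms by (simp add: oval_function_def)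
  have "ppoint m ` cone g \<subseteq> ppoints m"
    using cone_space3[OF gF] by (auto simp: ppoints_def)
  moreover have "\<not> (\<exists>l\<in>plines m. P \<in> l \<and> Q \<in> l \<and> R \<in> l)"
    if PQR: "P \<in> ppoint m ` cone g" "Q \<in> ppoint m ` cone g" "R \<in> ppoint m ` cone g"
      "P \<noteq> Q" "Q \<noteq> R" "P \<noteq> R" for P Q R
  proof -
    obtain p q r where "p \<in> cone g" "q \<in> cone g" "r \<in> cone g"
      "P = ppoint m p" "Q = ppoint m q" "R = ppoint m r"
      using PQR(1-3) by blast
    thus ?thesis
      using PQR(4-6) det3_cone[OF assms, of p q r] det3_collinear[of _ p q r] by blast
  qed
  ultimately show ?thesis
    unfolding hyperoval_def card_g_hyperoval[OF gF] unfolding g_hyperoval_eq[OF gF] by blast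
qed

text \<open>
  The substitution \<open>v \<mapsto> c / (c\<^sup>q v)\<close> exchanges the two roots and preserves the unit circle.
\<close>

lemma card_quadratic_S:
  assumes e: "e \<in> F" "e \<noteq> 0"
  shows "card {v \<in> S. cj c * v\<^sup>2 + e * v + c = 0} \<in> {0, 2}" (is "card ?A \<in> _")
proof (cases "?A = {}")
  case False
  then obtain v where v: "v \<in> S" "cj c * v\<^sup>2 + e * v + c = 0" by auto
  have v0: "v \<noteq> 0" using v S_nz by blast
  have c0: "c \<noteq> 0" using v v0 e by (auto simp: cj_simps)
  hence c0': "cj c \<noteq> 0" by (simp add: cj_eq_0)
  define w where "w = c / (cj c * v)"
  have wS: "w \<in> S"
    using v c0 c0' v0 by (simp add: w_def S_iff cj_simps S_cj field_simps)
  have vw: "cj c * (v + w) = e"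
  proof -
    have "v * (cj c * (v + w)) = cj c * v\<^sup>2 + c"
      using c0' v0 by (simp add: w_def power2_eq_square field_simps)
    also have "\<dots> = v * e"
    proof -
      have "cj c * v\<^sup>2 + c + v * e = 0" using v by (simp add: ac_simps)
      thus ?thesis by (simp only: add_eq_0_char2)
    qed
    finally show ?thesis using v0 by simp
  qed
  have "?A = {v, w}"
  proof (intro equalityI subsetI)
    fix x assume "x \<in> ?A"
    hence "cj c * x\<^sup>2 + e * x + c = 0" by simp
    moreover have "c = cj c * v * w" using c0' v0 by (simp add: w_def)
    ultimately have "cj c * ((x + v) * (x + w)) = 0"
      using vw by (simp add: algebra_simps power2_eq_square flip: vw)
    thus "x \<in> {v, w}" using c0' by (auto simp: add_eq_0_char2)
  next
    have "c = cj c * v * w" using c0' v0 by (simp add: w_def)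
    hence "cj c * w\<^sup>2 + e * w + c = 0"
      by (simp add: power2_eq_square algebra_simps flip: vw)
    thus "x \<in> {v, w} \<Longrightarrow> x \<in> ?A" for x using v wS by auto
  qed
  \<comment> \<open>The roots add up to \<open>e / cj c\<close>, so \<open>e \<noteq> 0\<close>
    excludes a double root in characteristic 2.\<close>
  moreover have "v \<noteq> w" using vw e by auto
  ultimately show ?thesis by simp
qed simp

section \<open>The two g-functions satisfy the counting condition\<close>

lemma oval_function_one: "oval_function (\<lambda>u. 1)"
  unfolding oval_function_def
proof (intro conjI ballI allI)
  fix b
  have "(1 = T (b * cj u)) \<longleftrightarrow> cj b * u\<^sup>2 + 1 * u + b = 0" if u: "u \<in> S" for u
  proof -
    have "T (b * cj u) + 1 = (cj b * u\<^sup>2 + 1 * u + b) / u"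
      using u S_nz[OF u] by (simp add: cj_simps S_cj field_simps power2_eq_square)
    thus ?thesis using S_nz[OF u] by (metis add_eq_0_char2 divide_eq_0_iff)
  qed
  hence "{u \<in> S. 1 = T (b * cj u)} = {u \<in> S. cj b * u\<^sup>2 + 1 * u + b = 0}" by blast
  thus "card {u \<in> S. 1 = T (b * cj u)} \<in> {0, 2}"
    using card_quadratic_S[OF F_1, of b] by simp
qed (simp add: F_1)

text \<open>With \<open>t = T u\<close> and \<open>u * cj u = 1\<close> the numerator is
  \<open>t ^ 3 + t\<close> and the denominator \<open>t ^ 2\<close>.\<close>

lemma g_last_eq:
  assumes "u \<in> S" "u \<noteq> 1"
  shows "g_last m u = T u + 1 / T u"
proof -
  have nz: "u + cj u \<noteq> 0" using assms S_T_0 by blast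
  have uu: "u * cj u = 1" using assms by (simp add: S_iff)
  define t where "t = T u"
  have "u * u\<^sup>2 + cj u * (cj u)\<^sup>2 = T u * ((T u)\<^sup>2 + u * cj u)"
    by (simp add: power2_eq_square algebra_simps)
  hence "g_last m u = t * (t\<^sup>2 + 1) / t\<^sup>2"
    using assms by (simp add: g_last_def sq_add uu t_def)
  also have "\<dots> = t + 1 / t"
    using nz by (simp add: t_def [symmetric] power2_eq_square field_simps)
  finally show ?thesis by (simp add: t_def)
qed

lemma g_last_F: "u \<in> S \<Longrightarrow> g_last m u \<in> F"
  using g_last_eq[of u] F_1 by (cases "u = 1") (auto simp: g_last_def intro!: F_add F_divide F_T)

text \<open>Multiplied by \<open>u^2 * T u\<close>, the condition for \<open>u \<noteq> 1\<close>
  becomes a quadratic in \<open>v = u^2\<close> of the kind already counted, with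
  \<open>c = 1 + b\<close> and \<open>e = 1 + T b\<close>; squaring permutes \<open>S\<close>. The
  exceptional point 1 satisfies its condition exactly when \<open>e = 0\<close>, where the quadratic
  has a single root, and so supplies the second solution.\<close>

lemma oval_function_g_last: "oval_function (g_last m)"
  unfolding oval_function_def
proof (intro conjI ballI allI)
  fix b
  let ?e = "1 + T b"
  let ?A = "{u \<in> S. g_last m u = T (b * cj u)}"
  let ?P = "\<lambda>v. cj (1 + b) * v\<^sup>2 + ?e * v + (1 + b) = 0"
  have eF: "?e \<in> F" by (intro F_add F_1 F_T)
  have P: "g_last m u = T (b * cj u) \<longleftrightarrow> ?P (u\<^sup>2)" if u: "u \<in> S" "u \<noteq> 1" for u
  proof -
    have nz: "T u \<noteq> 0" using u S_T_0 by blast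
    have uu: "u * cj u = 1" using u by (simp add: S_iff)
    have Tu: "T u = (u\<^sup>2 + 1) / u" and Tb: "T (b * cj u) = (cj b * u\<^sup>2 + b) / u"
      using u S_nz[of u] by (simp_all add: cj_simps S_cj field_simps power2_eq_square)
    have mult_out: "u\<^sup>2 * t * (t + 1 / t + z) = u\<^sup>2 * (t\<^sup>2 + 1 + t * z)" if "t \<noteq> 0" for t z
      using that by (simp add: power2_eq_square distrib_left mult.assoc)
    have u0: "u\<^sup>2 * T u \<noteq> 0" using nz u S_nz by simp
    have "u\<^sup>2 * T u * (g_last m u + T (b * cj u)) = u\<^sup>2 * ((T u)\<^sup>2 + 1 + T u * T (b * cj u))"
      unfolding g_last_eq[OF u] by (rule mult_out) (rule nz)
    also have "\<dots> = (u\<^sup>2 + 1)\<^sup>2 + u\<^sup>2 + (u\<^sup>2 + 1) * (cj b * u\<^sup>2 + b)"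
      unfolding Tu Tb using u S_nz[of u]
      by (simp add: distrib_left power_divide) (simp add: power2_eq_square add_divide_distrib)
    also have "\<dots> = cj (1 + b) * (u\<^sup>2)\<^sup>2 + ?e * u\<^sup>2 + (1 + b)"
      by (simp add: cj_simps power2_eq_square distrib_left distrib_right ac_simps)
    finally show ?thesis using u0 by (metis add_eq_0_char2 mult_eq_0_iff)
  qed
  have sq: "bij_betw (\<lambda>u. u\<^sup>2) S S"
  proof -
    have inj: "inj_on (\<lambda>u. u\<^sup>2) S" by (simp add: inj_on_def sq_inj)
    moreover have "(\<lambda>u. u\<^sup>2) ` S = S"
      using inj by (intro endo_inj_surj) (auto intro: S_power)
    ultimately show ?thesis by (simp add: bij_betw_def)
  qed
  have A1: "1 \<in> ?A \<longleftrightarrow> T b = 1"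
    by (auto simp: S_1 g_last_def cj_1)
  \<comment> \<open>At \<open>v = 1\<close> all occurrences of \<open>b\<close> cancel and three
    ones remain, so 1 is never a root of the quadratic.\<close>
  have "(3::'k) = 2 + 1" by simp
  hence P1: "\<not> ?P 1"
    by (simp add: cj_simps two_eq_0)
  show "card ?A \<in> {0, 2}"
  proof (cases "T b = 1")
    case False
    have "g_last m u = T (b * cj u) \<longleftrightarrow> ?P (u\<^sup>2)" if "u \<in> S" for u
      using P[OF that] A1 P1 False S_1 by (cases "u = 1") simp_all
    hence "?A = {u \<in> S. ?P (u\<^sup>2)}" by blast
    moreover have "bij_betw (\<lambda>u. u\<^sup>2) {u \<in> S. Q (u\<^sup>2)} {v \<in> S. Q v}" for Q
      using sq unfolding bij_betw_def inj_on_def by auto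
    from this[of ?P] have "bij_betw (\<lambda>u. u\<^sup>2) {u \<in> S. ?P (u\<^sup>2)} {v \<in> S. ?P v}" .
    ultimately have "card ?A = card {v \<in> S. ?P v}" by (simp only: bij_betw_same_card)
    moreover have "?e \<noteq> 0" using False by (metis add_eq_0_char2)
    ultimately show ?thesis using card_quadratic_S[OF eF] by simp
  next
    case True
    have b1: "1 + b \<noteq> 0" using True by (auto simp: add_eq_0_char2 cj_1)
    hence b1': "cj (1 + b) \<noteq> 0" using cj_eq_0 by blast
    have "(1 + b) / cj (1 + b) \<in> S"
      using b1 b1' by (simp add: S_iff cj_divide cj_cj)
    \<comment> \<open>Without its linear term the quadratic determines \<open>v^2\<close>, hence
      \<open>u ^ 4\<close>, so squaring is inverted on \<open>S\<close> twice.\<close>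
    then obtain w where w: "w \<in> S" "(w\<^sup>2)\<^sup>2 = (1 + b) / cj (1 + b)"
      using sq by (metis (no_types, lifting) bij_betw_imp_surj_on imageE)
    have Pw: "?P (u\<^sup>2) \<longleftrightarrow> u = w" for u
    proof -
      have "?P (u\<^sup>2) \<longleftrightarrow> cj (1 + b) * (u\<^sup>2)\<^sup>2 = 1 + b"
        unfolding True by (simp add: add_eq_0_char2)
      also have "\<dots> \<longleftrightarrow> (u\<^sup>2)\<^sup>2 = (w\<^sup>2)\<^sup>2"
        unfolding w(2) eq_divide_eq using b1' by (simp add: mult.commute)
      also have "\<dots> \<longleftrightarrow> u = w" by (simp only: sq_inj)
      finally show ?thesis .
    qed
    have "w \<noteq> 1" using P1 Pw[of 1] by auto
    moreover have "?A = {1, w}"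
      using P A1 Pw True w(1) by auto
    ultimately show ?thesis by simp
  qed
qed (rule g_last_F)

section \<open>Collineations and equivalence\<close>

lemma space3_iff: "(x, z) \<in> space3 m \<longleftrightarrow> (z :: 'k) \<in> F"
  by (simp add: space3_def)

lemma space3_smul: "c \<in> F \<Longrightarrow> v \<in> space3 m \<Longrightarrow> smul c v \<in> space3 m"
  by (auto simp: space3_def smul_def F_mult)

lemma automorphism_0_1:
  assumes "subF_automorphism m \<sigma>"
  shows "\<sigma> (0 :: 'k) = 0" "\<sigma> (1 :: 'k) = 1"
proof -
  have add: "\<sigma> (0 + 0) = \<sigma> 0 + \<sigma> 0" and mult: "\<sigma> (1 * 1) = \<sigma> 1 * \<sigma> 1"
    and inj: "inj_on \<sigma> F"
    using assms F_0 F_1 unfolding subF_automorphism_def bij_betw_def by blast+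
  show 0: "\<sigma> 0 = 0" using add by simp
  have "\<sigma> 1 \<noteq> 0" using inj_onD[OF inj, of 1 0] 0 F_0 F_1 by auto
  thus "\<sigma> 1 = 1" using mult by simp
qed

lemma automorphism_F: "subF_automorphism m \<sigma> \<Longrightarrow> x \<in> F \<Longrightarrow> \<sigma> x \<in> F"
  unfolding subF_automorphism_def by (auto simp: bij_betw_def)

text \<open>\<open>\<sigma>\<close> commutes with powers and sums, so it carries the trace of
  \<open>x\<close> to that of \<open>\<sigma> x\<close>; but the trace is 0 or 1, which
  \<open>\<sigma>\<close> fixes.\<close>

lemma tr_automorphism:
  assumes \<sigma>: "subF_automorphism m \<sigma>" and x: "x \<in> F"
  shows "tr (\<sigma> x) = tr x"
proof -
  have add: "\<sigma> (x + y) = \<sigma> x + \<sigma> y" and mult: "\<sigma> (x * y) = \<sigma> x * \<sigma> y" if "x \<in> F" "y \<in> F" for x y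
    using \<sigma> that unfolding subF_automorphism_def by blast+
  have pow: "\<sigma> (x ^ k) = \<sigma> x ^ k" for k
    using x by (induction k) (auto simp: mult F_power automorphism_0_1[OF \<sigma>])
  have "\<sigma> (\<Sum>i<n. x ^ (2 ^ i)) = (\<Sum>i<n. \<sigma> x ^ (2 ^ i)) \<and> (\<Sum>i<n. x ^ (2 ^ i)) \<in> F" for n
    using x by (induction n) (auto simp: F_closed add pow automorphism_0_1[OF \<sigma>])
  hence "tr (\<sigma> x) = \<sigma> (tr x)" by (simp add: trF_def)
  thus ?thesis using tr_01[OF x] automorphism_0_1[OF \<sigma>] by auto
qed

lemma semilinear_image_ppoint:
  assumes "semilinear_bij m \<phi>" "v \<in> space3 m"
  shows "\<phi> ` ppoint m v = ppoint m (\<phi> v :: 'k \<times> 'k)"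
proof -
  obtain \<sigma> where \<sigma>: "subF_automorphism m \<sigma>"
    and h: "\<And>c v. c \<in> F \<Longrightarrow> v \<in> space3 m \<Longrightarrow> \<phi> (smul c v) = smul (\<sigma> c) (\<phi> v)"
    using assms(1) unfolding semilinear_bij_def by blast
  have "\<phi> ` ppoint m v = (\<lambda>c. smul (\<sigma> c) (\<phi> v)) ` F"
    using assms(2) h by (simp add: ppoint_def image_image)
  also have "\<dots> = (\<lambda>c. smul c (\<phi> v)) ` (\<sigma> ` F)" by (simp add: image_image)
  also have "\<sigma> ` F = F" using \<sigma> unfolding subF_automorphism_def bij_betw_def by blast
  finally show ?thesis by (simp add: ppoint_def)
qed

lemma ppoint_space3: "v \<in> space3 m \<Longrightarrow> ppoint m v \<subseteq> (space3 m :: ('k \<times> 'k) set)"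
  unfolding ppoint_def using space3_smul by blast

lemma semilinear_bij_comp:
  assumes \<phi>: "semilinear_bij m \<phi>" and \<psi>: "semilinear_bij m (\<psi> :: 'k \<times> 'k \<Rightarrow> 'k \<times> 'k)"
  shows "semilinear_bij m (\<psi> \<circ> \<phi>)"
proof -
  obtain \<sigma> where \<sigma>: "subF_automorphism m \<sigma>"
    and h: "\<And>c v. c \<in> F \<Longrightarrow> v \<in> space3 m \<Longrightarrow> \<phi> (smul c v) = smul (\<sigma> c) (\<phi> v)"
    using \<phi> unfolding semilinear_bij_def by blast
  obtain \<tau> where \<tau>: "subF_automorphism m \<tau>"
    and h': "\<And>c v. c \<in> F \<Longrightarrow> v \<in> space3 m \<Longrightarrow> \<psi> (smul c v) = smul (\<tau> c) (\<psi> v)"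
    using \<psi> unfolding semilinear_bij_def by blast
  have mem: "\<phi> v \<in> space3 m" if "v \<in> space3 m" for v
    using \<phi> that unfolding semilinear_bij_def bij_betw_def by blast
  have "bij_betw (\<tau> \<circ> \<sigma>) F F"
    using \<sigma> \<tau> unfolding subF_automorphism_def by (metis bij_betw_trans)
  hence "subF_automorphism m (\<tau> \<circ> \<sigma>)"
    using \<sigma> \<tau> automorphism_F[OF \<sigma>] unfolding subF_automorphism_def by simp
  moreover have "\<forall>c\<in>F. \<forall>v\<in>space3 m. (\<psi> \<circ> \<phi>) (smul c v) = smul ((\<tau> \<circ> \<sigma>) c) ((\<psi> \<circ> \<phi>) v)"
    using h h' mem automorphism_F[OF \<sigma>] by simp
  moreover have "bij_betw (\<psi> \<circ> \<phi>) (space3 m) (space3 m)"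
    using \<phi> \<psi> unfolding semilinear_bij_def by (metis bij_betw_trans)
  moreover have "\<forall>v\<in>space3 m. \<forall>w\<in>space3 m. (\<psi> \<circ> \<phi>) (v + w) = (\<psi> \<circ> \<phi>) v + (\<psi> \<circ> \<phi>) w"
    using \<phi> \<psi> mem unfolding semilinear_bij_def by simp
  ultimately show ?thesis unfolding semilinear_bij_def by blast
qed

text \<open>A left inverse suffices because \<open>space3 m\<close> is finite. The field
  automorphism is the identity here.\<close>

lemma semilinear_bij_linear:
  fixes \<phi> :: "'k \<times> 'k \<Rightarrow> 'k \<times> 'k"
  assumes "\<And>v. v \<in> space3 m \<Longrightarrow> \<phi> v \<in> space3 m" "\<And>v. v \<in> space3 m \<Longrightarrow> \<psi> (\<phi> v) = v"
    and "\<And>v w. v \<in> space3 m \<Longrightarrow> w \<in> space3 m \<Longrightarrow> \<phi> (v + w) = \<phi> v + \<phi> w"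
    and "\<And>c v. c \<in> F \<Longrightarrow> v \<in> space3 m \<Longrightarrow> \<phi> (smul c v) = smul c (\<phi> v)"
  shows "semilinear_bij m \<phi>"
proof -
  have inj: "inj_on \<phi> (space3 m)" using assms(2) by (metis inj_onI)
  hence "\<phi> ` space3 m = space3 m"
    by (intro endo_inj_surj) (use assms(1) in auto)
  hence "bij_betw \<phi> (space3 m) (space3 m)" using inj by (simp add: bij_betw_def)
  moreover have "subF_automorphism m (\<lambda>c::'k. c)"
    by (simp add: subF_automorphism_def bij_betw_def)
  ultimately show ?thesis using assms(3,4) unfolding semilinear_bij_def by blast
qed

text \<open>Only one inclusion has to be checked, vector by vector: the map is injective on points
  and both sides have \<open>2 ^ m + 2\<close> of them.\<close>

lemma semilinear_image_hyperoval:
  assumes \<phi>: "semilinear_bij m \<phi>" and gF: "\<forall>u\<in>S. g u \<in> F" "\<forall>u\<in>S. g' u \<in> F"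
    and cone: "\<And>v. v \<in> cone g \<Longrightarrow> \<exists>c\<in>F. \<exists>w\<in>cone g'. c \<noteq> 0 \<and> \<phi> v = smul c w"
  shows "(\<lambda>P. \<phi> ` P) ` g_hyperoval m g = g_hyperoval m g'"
proof (rule card_subset_eq)
  show "finite (g_hyperoval m g')" by simp
  have sub: "g_hyperoval m g \<subseteq> Pow (space3 m)"
    unfolding g_hyperoval_eq[OF gF(1)]
    using cone_space3[OF gF(1)] ppoint_space3 by blast
  have "inj_on \<phi> (space3 m)" using \<phi> unfolding semilinear_bij_def bij_betw_def by blast
  hence "inj_on ((`) \<phi>) (Pow (space3 m))" by (rule inj_on_image_Pow)
  hence "inj_on ((`) \<phi>) (g_hyperoval m g)" using sub by (rule inj_on_subset)
  thus "card ((\<lambda>P. \<phi> ` P) ` g_hyperoval m g) = card (g_hyperoval m g')"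
    by (simp add: card_image card_g_hyperoval gF)
  show "(\<lambda>P. \<phi> ` P) ` g_hyperoval m g \<subseteq> g_hyperoval m g'"
    unfolding g_hyperoval_eq[OF gF(1)] g_hyperoval_eq[OF gF(2)]
  proof safe
    fix v assume v: "v \<in> cone g"
    hence "\<phi> ` ppoint m v = ppoint m (\<phi> v)"
      using semilinear_image_ppoint[OF \<phi>] cone_space3[OF gF(1)] by blast
    moreover obtain c w where "c \<in> F" "w \<in> cone g'" "c \<noteq> 0" "\<phi> v = smul c w"
      using cone[OF v] by blast
    ultimately show "\<phi> ` ppoint m v \<in> ppoint m ` cone g'"
      using ppoint_smul by auto
  qed
qed

text \<open>
  After scaling, a collineation fixing the origin has the form
  \<open>(x, z) \<mapsto> (A x, l x + \<sigma> z)\<close>, and the trace does not see \<open>\<sigma>\<close>.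
\<close>

lemma boolean_equiv_if_collineation:
  assumes f: "is_g_function m f g" and f': "is_g_function m f' g'"
    and \<phi>: "semilinear_bij m \<phi>"
    and H: "(\<lambda>P. \<phi> ` P) ` g_hyperoval m g = g_hyperoval m g'"
    and orig: "\<phi> ` affine_point m 0 = affine_point m (0 :: 'k)"
  shows "(f', f) \<in> boolean_equiv"
proof -
  have gF: "\<forall>u\<in>S. g u \<in> F" and gF': "\<forall>u\<in>S. g' u \<in> F"
    using f f' by (auto simp: is_g_function_def)
  obtain \<sigma> where \<sigma>: "subF_automorphism m \<sigma>"
    and smul: "\<And>c v. c \<in> F \<Longrightarrow> v \<in> space3 m \<Longrightarrow> \<phi> (smul c v) = smul (\<sigma> c) (\<phi> v)"
    using \<phi> unfolding semilinear_bij_def by blast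
  have add: "\<phi> (v + w) = \<phi> v + \<phi> w" if "v \<in> space3 m" "w \<in> space3 m" for v w
    using \<phi> that unfolding semilinear_bij_def by blast
  have inj: "inj_on \<phi> (space3 m)" and mem: "\<And>v. v \<in> space3 m \<Longrightarrow> \<phi> v \<in> space3 m"
    using \<phi> unfolding semilinear_bij_def bij_betw_def by blast+
  have s0: "(0, 1) \<in> (space3 m :: ('k \<times> 'k) set)" "(x, 0) \<in> space3 m" for x :: 'k
    by (simp_all add: space3_iff F_0 F_1)
  have \<phi>0: "\<phi> (0, 0) = (0, 0)"
    using add[OF s0(2) s0(2), of 0 0] by (simp add: prod_eq_iff)
  have "ppoint m (\<phi> (0, 1)) = ppoint m (0, 1)"
    using orig semilinear_image_ppoint[OF \<phi> s0(1)] by (simp add: affine_point_def)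
  then obtain c where c: "c \<in> F" "\<phi> (0, 1) = (0, c)"
    using ppoint_eqD[of "\<phi> (0, 1)" "(0, 1)"] by (auto simp: smul_def)
  have c0: "c \<noteq> 0"
  proof
    assume "c = 0"
    hence "\<phi> (0, 1) = \<phi> (0, 0)" using c \<phi>0 by simp
    hence "(0, 1 :: 'k) = (0, 0 :: 'k)" using inj_onD[OF inj] s0 by blast
    thus False by simp
  qed
  have \<phi>z: "\<phi> (0, z) = (0, \<sigma> z * c)" if "z \<in> F" for z
    using smul[OF that s0(1)] c by (simp add: smul_def)
  define A where "A x = fst (\<phi> (x, 0)) / c" for x
  define l where "l x = snd (\<phi> (x, 0)) / c" for x
  have lF: "l x \<in> F" for x
    using mem[OF s0(2), of x] c by (auto simp: l_def space3_def intro: F_divide)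
  have \<phi>x: "\<phi> (x, 0) = (c * A x, c * l x)" for x
    using c0 by (simp add: A_def l_def prod_eq_iff)
  have sum0: "\<phi> (x + y, 0) = \<phi> (x, 0) + \<phi> (y, 0)" for x y
    using add[OF s0(2) s0(2), of x y] by simp
  have A_add: "A (x + y) = A x + A y" and l_add: "l (x + y) = l x + l y" for x y
    unfolding A_def l_def sum0 by (simp_all add: add_divide_distrib)
  have hom: "A (k * x) = \<sigma> k * A x" "l (k * x) = \<sigma> k * l x" if "k \<in> F" for k x
    using smul[OF that s0(2), of x] by (simp_all add: A_def l_def smul_def)
  \<comment> \<open>If \<open>A x = 0\<close>, the image of \<open>(x, 0)\<close> lies in the span
    of \<open>(0, 1)\<close>, where it is already the image of some \<open>(0, z)\<close>.\<close>
  have A0: "x = 0" if "A x = 0" for x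
  proof -
    have "\<sigma> ` F = F" using \<sigma> unfolding subF_automorphism_def bij_betw_def by blast
    then obtain z where z: "z \<in> F" "\<sigma> z = l x" using lF[of x] by (metis imageE)
    have "\<phi> (x, 0) = \<phi> (0, z)" using that z by (simp add: \<phi>x \<phi>z mult.commute)
    moreover have "(0, z) \<in> space3 m" using z by (simp add: space3_iff)
    ultimately have "(x, 0) = (0, z)" using inj_onD[OF inj] s0(2) by blast
    thus ?thesis by simp
  qed
  have "inj A"
  proof (rule injI)
    fix x y assume "A x = A y"
    hence "A (x + y) = 0" by (simp add: A_add)
    thus "x = y" using A0 add_eq_0_char2 by blast
  qed
  hence bij: "bij A" by (simp add: bij_def finite_UNIV_inj_surj)
  have eq: "f x = f' (A x) + tr (l x)" for x
  proof -
    obtain k u where x: "k \<in> F" "u \<in> S" "x = k * u" by (rule polar)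
    have gu: "g u \<in> F" using gF x by blast
    have pu: "(u, g u) \<in> space3 m" "(0, g u) \<in> space3 m" using gu by (simp_all add: space3_iff)
    have \<phi>u: "\<phi> (u, g u) = (c * A u, c * (l u + \<sigma> (g u)))"
      using add[OF s0(2) pu(2), of u] by (simp add: \<phi>x \<phi>z[OF gu] algebra_simps)
    have "\<phi> ` ppoint m (u, g u) \<in> g_hyperoval m g'"
      unfolding H [symmetric] g_hyperoval_eq[OF gF] using x by (auto simp: cone_def)
    then obtain w where w: "w \<in> cone g'" "ppoint m (\<phi> (u, g u)) = ppoint m w"
      unfolding semilinear_image_ppoint[OF \<phi> pu(1)] g_hyperoval_eq[OF gF'] by blast
    then obtain k' where k': "k' \<in> F" "\<phi> (u, g u) = smul k' w"
      using ppoint_eqD by blast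
    have "A u \<noteq> 0" using A0 S_nz x by blast
    hence "w \<noteq> (0, 1)" using k' c0 by (auto simp: \<phi>u smul_def)
    then obtain v where v: "v \<in> S" "w = (v, g' v)" using w by (auto simp: cone_def)
    \<comment> \<open>The coordinate of \<open>A x\<close> along \<open>v\<close>: semilinearity
      contributes \<open>\<sigma> k\<close>, the choice of spanning vector \<open>k'\<close>, and
      the normalisation of \<open>A\<close> the divisor \<open>c\<close>.\<close>
    let ?e = "\<sigma> k * k' / c"
    have Au: "A u = k' / c * v" and lu: "l u + \<sigma> (g u) = k' / c * g' v"
      using k' c0 unfolding \<phi>u v(2) by (simp_all add: smul_def field_simps)
    have "?e \<in> F" using automorphism_F[OF \<sigma> x(1)] k' c F_mult F_divide by blast
    hence "f' (?e * v) = tr (?e * g' v)" using f' v unfolding is_g_function_def by blast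
    also have "?e * v = A x" using x hom[of k u] Au by simp
    also have "?e * g' v = \<sigma> k * (l u + \<sigma> (g u))" using lu by simp
    also have "\<dots> = l x + \<sigma> (k * g u)"
      using \<sigma> x gu hom[of k u] unfolding subF_automorphism_def by (simp add: distrib_left)
    finally have "f' (A x) = tr (l x) + tr (k * g u)"
      using tr_automorphism[OF \<sigma>] F_mult x gu by (simp add: tr_add)
    thus ?thesis using f x by (simp add: is_g_function_def ac_simps)
  qed
  have "F2_affine (\<lambda>x. tr (l x))" by (rule F2_affine_additive) (simp add: l_add tr_add)
  moreover have "boolean_fun (\<lambda>x. tr (l x))"
    using tr_01[OF lF] by (auto simp: boolean_fun_def F2_def)
  moreover have "f = (\<lambda>x. f' (A x) + tr (l x))" using eq by blast
  ultimately show ?thesis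
    unfolding boolean_equiv_def
    using boolean_fun_niho[OF f] boolean_fun_niho[OF f'] bij F2_affine_additive[OF A_add] by blast
qed

text \<open>
  The hyperoval of \<^term>\<open>g_last m\<close> consists of the conic \<open>z T x + (T x)\<^sup>2 + N x = 0\<close> and its nucleus
  \<open>(1, 1)\<close>, and \<open>N (x + z) = (z T x + (T x)\<^sup>2 + N x) + (z + T x)\<^sup>2\<close>. Hence this collineation takes it
  to the hyperconic, the nucleus to the origin, and the origin to the point \<open>1\<close>.
\<close>

definition to_hyperconic :: "'k \<times> 'k \<Rightarrow> 'k \<times> 'k" where
  "to_hyperconic v = (fst v + snd v, snd v + T (fst v))"

definition from_hyperconic :: "'k \<times> 'k \<Rightarrow> 'k \<times> 'k" where
  "from_hyperconic v = (fst v + snd v + T (fst v), snd v + T (fst v))"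

lemma from_to_hyperconic: "v \<in> space3 m \<Longrightarrow> from_hyperconic (to_hyperconic v) = v"
  and to_from_hyperconic: "v \<in> space3 m \<Longrightarrow> to_hyperconic (from_hyperconic v) = v"
  by (auto simp: from_hyperconic_def to_hyperconic_def space3_def prod_eq_iff cj_simps F_cj ac_simps)

lemma semilinear_to_hyperconic: "semilinear_bij m to_hyperconic"
proof (rule semilinear_bij_linear[where \<psi> = from_hyperconic])
  show "to_hyperconic v \<in> space3 m" if "v \<in> space3 m" for v
    using that F_add[OF _ F_T] by (auto simp: to_hyperconic_def space3_def)
  show "from_hyperconic (to_hyperconic v) = v" if "v \<in> space3 m" for v
    using that by (rule from_to_hyperconic)
qed (auto simp: to_hyperconic_def smul_def cj_simps F_cj algebra_simps)

lemma semilinear_from_hyperconic: "semilinear_bij m from_hyperconic"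
proof (rule semilinear_bij_linear[where \<psi> = to_hyperconic])
  show "from_hyperconic v \<in> space3 m" if "v \<in> space3 m" for v
    using that F_add[OF _ F_T] by (auto simp: from_hyperconic_def space3_def)
  show "to_hyperconic (from_hyperconic v) = v" if "v \<in> space3 m" for v
    using that by (rule to_from_hyperconic)
qed (auto simp: from_hyperconic_def smul_def cj_simps F_cj algebra_simps)

lemma to_hyperconic_image:
  "(\<lambda>P. to_hyperconic ` P) ` g_hyperoval m (g_last m) = hyperconic m"
  unfolding hyperconic_eq
proof (rule semilinear_image_hyperoval[OF semilinear_to_hyperconic])
  show "\<forall>u\<in>S. g_last m u \<in> F" "\<forall>u\<in>S. 1 \<in> F" using g_last_F F_1 by auto
  fix v assume "v \<in> cone (g_last m)"
  then consider "v = (0, 1)" | "v = (1, 1)"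
    | u where "u \<in> S" "u \<noteq> 1" "v = (u, g_last m u)"
    by (auto simp: cone_def g_last_def split: if_splits)
  thus "\<exists>c\<in>F. \<exists>w\<in>cone (\<lambda>u. 1). c \<noteq> 0 \<and> to_hyperconic v = smul c w"
  proof cases
    case 1
    have "to_hyperconic v = smul 1 (1, 1)"
      by (simp add: 1 to_hyperconic_def smul_def cj_simps)
    thus ?thesis using F_1 S_1 by (intro bexI[of _ 1] bexI[of _ "(1, 1)"]) (auto simp: cone_def)
  next
    case 2
    have "to_hyperconic v = smul 1 (0, 1)"
      by (simp add: 2 to_hyperconic_def smul_def cj_simps)
    thus ?thesis using F_1 by (intro bexI[of _ 1] bexI[of _ "(0, 1)"]) (auto simp: cone_def)
  next
    case 3
    define t where "t = T u"
    have t0: "t \<noteq> 0" and tF: "cj t = t"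
      using 3 S_T_0 F_T[of u] by (auto simp: t_def F_iff)
    have g: "g_last m u = t + 1 / t" using 3 by (simp add: g_last_eq t_def)
    have cu: "cj u = u + t" by (simp add: t_def)
    have Nu: "u * u + t * u = 1" using 3 cu by (simp add: S_iff algebra_simps)
    \<comment> \<open>Since \<open>g_last m u + T u = 1 / t\<close>, multiplying the image of
      \<open>(u, g_last m u)\<close> by \<open>t\<close> makes its last coordinate 1 and its first
      \<open>w\<close>.\<close>
    define w where "w = t * (u + t) + 1"
    have eq: "to_hyperconic v = smul (1 / t) (w, 1)"
      using t0 unfolding 3 to_hyperconic_def smul_def g
      by (simp add: w_def field_simps flip: t_def)
    have "N w = 1"
    proof -
      have "cj w = t * u + 1" by (simp add: w_def cj_simps tF cu add.assoc)
      hence "N w = t * t * (u * u + t * u) + t * t + 1"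
        by (simp add: w_def algebra_simps)
      thus ?thesis by (simp add: Nu)
    qed
    hence "(w, 1) \<in> cone (\<lambda>u. 1)" by (simp add: cone_def S_iff)
    moreover have "1 / t \<in> F" "1 / t \<noteq> 0" using t0 tF by (simp_all add: F_iff cj_simps)
    ultimately show ?thesis using eq by blast
  qed
qed

lemma from_hyperconic_image:
  "(\<lambda>P. from_hyperconic ` P) ` hyperconic m = g_hyperoval m (g_last m)"
proof -
  have gF: "\<forall>u\<in>S. g_last m u \<in> F" using g_last_F by blast
  have "from_hyperconic ` to_hyperconic ` P = P" if "P \<in> g_hyperoval m (g_last m)" for P
  proof -
    have "P \<subseteq> space3 m"
      using that cone_space3[OF gF] ppoint_space3 unfolding g_hyperoval_eq[OF gF] by blast
    thus ?thesis using from_to_hyperconic by (force simp: image_image)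
  qed
  thus ?thesis unfolding to_hyperconic_image [symmetric] by (simp add: image_image)
qed

section \<open>Rotations of the hyperconic and the two cases\<close>

definition rotate :: "'k \<Rightarrow> 'k \<times> 'k \<Rightarrow> 'k \<times> 'k" where
  "rotate w v = (fst v / w, snd v)"

lemma semilinear_rotate: "w \<in> S \<Longrightarrow> semilinear_bij m (rotate w)"
  by (rule semilinear_bij_linear[where \<psi> = "rotate (1 / w)"])
    (auto simp: rotate_def space3_def smul_def S_nz add_divide_distrib)

lemma rotate_image:
  assumes "w \<in> S"
  shows "(\<lambda>P. rotate w ` P) ` hyperconic m = hyperconic m"
  unfolding hyperconic_eq
proof (rule semilinear_image_hyperoval[OF semilinear_rotate[OF assms]])
  fix v :: "'k \<times> 'k" assume "v \<in> cone (\<lambda>u. 1)"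
  hence "rotate w v = smul 1 (rotate w v)" "rotate w v \<in> cone (\<lambda>u. 1)"
    using assms by (auto simp: smul_def cone_def rotate_def S_divide)
  thus "\<exists>c\<in>F. \<exists>w'\<in>cone (\<lambda>u. 1). c \<noteq> 0 \<and> rotate w v = smul c w'"
    using F_1 one_neq_zero by blast
qed (auto simp: F_1)

lemma niho_bent_hyperconic_cases:
  fixes f :: "'k \<Rightarrow> 'k"
  assumes f: "f \<in> niho_bent_assoc m (hyperconic m)"
    and f1: "is_g_function m f1 (\<lambda>u. 1)" and fl: "is_g_function m fl (g_last m)"
  shows "(f1, f) \<in> boolean_equiv \<or> (fl, f) \<in> boolean_equiv"
proof -
  obtain g \<phi> where g: "is_g_function m f g" and \<phi>: "semilinear_bij m \<phi>"
    and H: "(\<lambda>P. \<phi> ` P) ` g_hyperoval m g = hyperconic m"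
    using f unfolding niho_bent_assoc_def associated_with_def proj_equivalent_def by blast
  have O: "affine_point m 0 \<in> g_hyperoval m g" by (simp add: g_hyperoval_def)
  hence "\<phi> ` affine_point m 0 \<in> hyperconic m" using H by blast
  then consider "\<phi> ` affine_point m 0 = affine_point m 0"
    | w where "w \<in> S" "\<phi> ` affine_point m 0 = affine_point m w"
    by (auto simp: hyperconic_def)
  thus ?thesis
  proof cases
    case 1
    thus ?thesis
      using boolean_equiv_if_collineation[OF g f1 \<phi>] H unfolding hyperconic_eq by blast
  next
    case 2
    \<comment> \<open>The origin travels to \<open>w\<close>, is rotated to 1 and returns to the
      origin, so \<open>boolean_equiv_if_collineation\<close> applies to this composite.\<close>
    let ?\<psi> = "from_hyperconic \<circ> rotate w \<circ> \<phi>"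
    have sp: "(w, 1) \<in> space3 m" "(1, 1) \<in> (space3 m :: ('k \<times> 'k) set)"
      by (simp_all add: space3_iff F_1)
    have "semilinear_bij m ?\<psi>"
      by (metis \<phi> semilinear_from_hyperconic semilinear_rotate[OF 2(1)] semilinear_bij_comp comp_assoc)
    moreover have "(\<lambda>P. ?\<psi> ` P) ` g_hyperoval m g
        = (\<lambda>P. from_hyperconic ` P) ` (\<lambda>P. rotate w ` P) ` (\<lambda>P. \<phi> ` P) ` g_hyperoval m g"
      by (simp add: image_image image_comp)
    hence "(\<lambda>P. ?\<psi> ` P) ` g_hyperoval m g = g_hyperoval m (g_last m)"
      unfolding H rotate_image[OF 2(1)] from_hyperconic_image .
    moreover have "?\<psi> ` affine_point m 0 = from_hyperconic ` rotate w ` ppoint m (w, 1)"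
      unfolding 2(2)[unfolded affine_point_def, symmetric] by (simp add: image_comp affine_point_def)
    hence "?\<psi> ` affine_point m 0 = affine_point m 0"
      using S_nz[OF 2(1)]
      unfolding semilinear_image_ppoint[OF semilinear_rotate[OF 2(1)] sp(1)]
      by (simp add: rotate_def semilinear_image_ppoint[OF semilinear_from_hyperconic sp(2)])
        (simp add: from_hyperconic_def affine_point_def cj_1)
    ultimately show ?thesis
      using boolean_equiv_if_collineation[OF g fl] by blast
  qed
qed

lemma proj_equivalent_refl: "proj_equivalent m H (H :: ('k \<times> 'k) set set)"
  unfolding proj_equivalent_def
  by (intro exI[of _ "\<lambda>v. v"] conjI semilinear_bij_linear[where \<psi> = "\<lambda>v. v"]) auto

lemma niho_bent_assoc_one:
  fixes f :: "'k \<Rightarrow> 'k"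
  shows "is_g_function m f (\<lambda>u. 1) \<Longrightarrow> f \<in> niho_bent_assoc m (hyperconic m)"
  unfolding niho_bent_assoc_def niho_bent_def associated_with_def
  using bent_niho oval_function_one hyperoval_oval_function
    proj_equivalent_refl[of "hyperconic m"] hyperconic_eq by auto

lemma niho_bent_assoc_g_last:
  fixes f :: "'k \<Rightarrow> 'k"
  shows "is_g_function m f (g_last m) \<Longrightarrow> f \<in> niho_bent_assoc m (hyperconic m)"
  unfolding niho_bent_assoc_def niho_bent_def associated_with_def proj_equivalent_def
  using bent_niho oval_function_g_last hyperoval_oval_function
    semilinear_to_hyperconic to_hyperconic_image by auto

section \<open>Inequivalence\<close>

lemma boolean_fun_add:
  fixes f f' :: "'k \<Rightarrow> 'k"
  assumes "boolean_fun f" "boolean_fun f'"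
  shows "boolean_fun (\<lambda>x. f x + f' x)"
proof -
  have "f x \<in> F2" "f' x \<in> F2" for x using assms by (auto simp: boolean_fun_def)
  hence "f x + f' x \<in> F2" for x unfolding F2_def by (metis add_0 add_0_right char2 insert_iff singletonD)
  thus ?thesis by (auto simp: boolean_fun_def)
qed

lemma boolean_fun_comp: "boolean_fun (f :: 'k \<Rightarrow> 'k) \<Longrightarrow> boolean_fun (\<lambda>x. f (h x))"
  by (auto simp: boolean_fun_def)

lemma equiv_boolean_equiv: "equiv {f :: 'k \<Rightarrow> 'k. boolean_fun f} boolean_equiv"
proof (rule equivI)
  show "boolean_equiv \<subseteq> {f :: 'k \<Rightarrow> 'k. boolean_fun f} \<times> {f. boolean_fun f}"
    by (auto simp: boolean_equiv_def)
  have id: "F2_affine (\<lambda>x::'k. x)" "F2_affine (\<lambda>x::'k. 0)" "boolean_fun (\<lambda>x::'k. 0)"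
    by (simp_all add: F2_affine_iff boolean_fun_def F2_def)
  show "refl_on {f :: 'k \<Rightarrow> 'k. boolean_fun f} boolean_equiv"
  proof (rule refl_onI)
    fix f :: "'k \<Rightarrow> 'k" assume "f \<in> {f. boolean_fun f}"
    moreover have "bij (\<lambda>x::'k. x)" "f = (\<lambda>x. f x + 0)" by (simp_all add: bij_def)
    ultimately show "(f, f) \<in> boolean_equiv"
      unfolding boolean_equiv_def using id by fast
  qed
  show "sym (boolean_equiv :: (('k \<Rightarrow> 'k) \<times> _) set)"
  proof (rule symI)
    fix f f' :: "'k \<Rightarrow> 'k" assume "(f, f') \<in> boolean_equiv"
    then obtain L l where L: "boolean_fun f" "boolean_fun f'" "F2_affine L" "bij L" "F2_affine l"
      "boolean_fun l" and f': "f' = (\<lambda>x. f (L x) + l x)"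
      unfolding boolean_equiv_def by blast
    have "L (inv L x) = x" for x using L(4) by (simp add: bij_is_surj surj_f_inv_f)
    hence "f = (\<lambda>x. f' (inv L x) + l (inv L x))" by (simp add: f' add.assoc)
    moreover have "F2_affine (inv L)" "bij (inv L)"
      "F2_affine (\<lambda>x. l (inv L x))" "boolean_fun (\<lambda>x. l (inv L x))"
      using L F2_affine_inv F2_affine_comp boolean_fun_comp bij_imp_bij_inv by blast+
    ultimately show "(f', f) \<in> boolean_equiv"
      unfolding boolean_equiv_def using L(1,2) by fast
  qed
  show "trans (boolean_equiv :: (('k \<Rightarrow> 'k) \<times> _) set)"
  proof (rule transI)
    fix f f' f'' :: "'k \<Rightarrow> 'k"
    assume "(f, f') \<in> boolean_equiv" "(f', f'') \<in> boolean_equiv"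
    then obtain L l M k where L: "boolean_fun f" "F2_affine L" "bij L" "F2_affine l" "boolean_fun l"
      and M: "boolean_fun f''" "F2_affine M" "bij M" "F2_affine k" "boolean_fun k"
      and eq: "f' = (\<lambda>x. f (L x) + l x)" "f'' = (\<lambda>x. f' (M x) + k x)"
      unfolding boolean_equiv_def by blast
    have "f'' = (\<lambda>x. f (L (M x)) + (l (M x) + k x))" by (simp add: eq add.assoc)
    moreover have "F2_affine (\<lambda>x. L (M x))" "F2_affine (\<lambda>x. l (M x) + k x)"
      using L M F2_affine_comp F2_affine_add by blast+
    moreover have "bij (\<lambda>x. L (M x))" using bij_comp[OF M(3) L(3)] by (simp add: comp_def)
    moreover have "boolean_fun (\<lambda>x. l (M x) + k x)"
      using L M boolean_fun_comp boolean_fun_add by blast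
    ultimately show "(f, f'') \<in> boolean_equiv"
      unfolding boolean_equiv_def using L(1) M(1) by fast
  qed
qed

section \<open>Third differences\<close>

text \<open>The third derivative at \<open>w\<close> in the directions \<open>x\<close>,
  \<open>y\<close>, \<open>z\<close>; in characteristic 2 all signs are positive. It annihilates
  functions of algebraic degree at most two.\<close>

definition third_diff :: "('k \<Rightarrow> 'k) \<Rightarrow> 'k \<Rightarrow> 'k \<Rightarrow> 'k \<Rightarrow> 'k \<Rightarrow> 'k" where
  "third_diff f w x y z = f w + f (w + x) + f (w + y) + f (w + z)
     + f (w + x + y) + f (w + x + z) + f (w + y + z) + f (w + x + y + z)"

text \<open>The affine summand cancels, and the affine substitution moves the base point from 0 to
  its constant \<open>c\<close>; hence vanishing is assumed at every base point but obtained at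
  0.\<close>

lemma third_diff_boolean_equiv:
  assumes "(f, f') \<in> boolean_equiv" and f: "\<And>w x y z. third_diff f w x y z = 0"
  shows "third_diff f' 0 x y z = 0"
proof -
  obtain L l where L: "F2_affine L" and l: "F2_affine l" and f': "f' = (\<lambda>x. f (L x) + l x)"
    using assms(1) unfolding boolean_equiv_def by blast
  obtain A c where L: "\<And>x. L x = A x + c" "\<And>x y. A (x + y) = A x + A y"
    using L unfolding F2_affine_def F2_linear_def by blast
  obtain B e where l: "\<And>x. l x = B x + e" "\<And>x y. B (x + y) = B x + B y"
    using l unfolding F2_affine_def F2_linear_def by blast
  have "A 0 = 0" "B 0 = 0" using L(2)[of 0 0] l(2)[of 0 0] by simp_all
  hence "third_diff f' 0 x y z = third_diff f c (A x) (A y) (A z)"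
    by (simp add: third_diff_def f' L l ac_simps)
  thus ?thesis by (simp add: f)
qed

lemma third_diff_tr_N: "third_diff (\<lambda>x. tr (N x)) w x y z = 0"
  unfolding third_diff_def tr_add [symmetric]
  by (simp add: cj_add distrib_left distrib_right ac_simps tr_0)

text \<open>With \<open>x = l * u\<close> and \<open>l^2 = N x\<close>, the product
  \<open>l * (T u + 1 / T u)\<close> depends on \<open>T x\<close> and \<open>N x\<close> alone. The
  ray \<open>u = 1\<close> is \<open>F\<close>, where \<open>T\<close> vanishes.\<close>

lemma g_last_fun_eq:
  assumes f: "is_g_function m f (g_last m)"
  shows "T x \<noteq> 0 \<Longrightarrow> f x = tr (T x + N x / T x)"
    and "x \<in> F \<Longrightarrow> f x = tr x"
proof -
  assume Tx: "T x \<noteq> 0"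
  obtain l u where x: "l \<in> F" "u \<in> S" "x = l * u" "l\<^sup>2 = N x" by (rule polar)
  have Txl: "T x = l * T u" using x T_scale by simp
  hence l: "l \<noteq> 0" "T u \<noteq> 0" using Tx by auto
  hence "u \<noteq> 1" using x S_T_0 by blast
  hence "l * g_last m u = l * T u + l / T u"
    using x g_last_eq by (simp add: distrib_left)
  also have "\<dots> = T x + N x / T x"
    unfolding Txl x(4) [symmetric] using l by (simp add: power2_eq_square)
  finally show "f x = tr (T x + N x / T x)" using f x by (simp add: is_g_function_def)
next
  assume "x \<in> F"
  hence "f (x * 1) = tr (x * g_last m 1)" using f S_1 unfolding is_g_function_def by blast
  thus "f x = tr x" by (simp add: g_last_def)
qed

lemma N_polar: "l \<in> F \<Longrightarrow> u \<in> S \<Longrightarrow> N (l * u) = l\<^sup>2"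
  by (simp add: cj_mult F_cj S_iff power2_eq_square mult.assoc mult.left_commute[of u])

lemma trK_add: "trK m (x + y :: 'k) = trK m x + trK m y"
  unfolding trK_eq T_add tr_add ..

context
  fixes a :: 'k
  assumes Ta: "T a = 1"
begin

lemma f_one_eq: "f_one m a x = tr (N x)"
proof -
  have "x ^ (2 ^ m + 1) = N x" by (simp add: conj_q_def)
  moreover have "T (N x * a) = N x" using T_scale[OF F_N] Ta by simp
  ultimately show ?thesis by (simp only: f_one_def trK_eq mult.commute[of a])
qed

lemma is_g_function_f_one: "is_g_function m (f_one m a) (\<lambda>u. 1)"
  unfolding is_g_function_def by (simp add: F_1 f_one_eq N_polar tr_sq)

text \<open>Since \<open>T a = 1\<close>, the elements 1 and \<open>a\<close> form an F-basis in
  which \<open>T\<close> is the second coordinate. Everything but \<open>s^2 / t\<close> is additive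
  in \<open>(s, t)\<close> and drops out of third differences.\<close>

lemma g_last_coordinates:
  assumes f: "is_g_function m f (g_last m)" and "s \<in> F" "t \<in> F" "t \<noteq> 0"
  shows "f (s + t * a) = tr (s\<^sup>2 / t + s + t * (1 + N a))"
proof -
  have ca: "cj a = a + 1" using Ta by (metis add_eq_0_char2 add.assoc char2_left)
  have t: "T (s + t * a) = t"
    using assms by (simp add: T_add T_F T_scale Ta)
  have "N (s + t * a) = s\<^sup>2 + s * t + t\<^sup>2 * N a"
    using assms(2,3) by (simp add: cj_simps F_cj ca power2_eq_square algebra_simps)
  hence "T (s + t * a) + N (s + t * a) / T (s + t * a) = s\<^sup>2 / t + s + t * (1 + N a)"
    unfolding t using assms(4)
    by (simp add: add_divide_distrib power2_eq_square distrib_left ac_simps)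
  thus ?thesis using g_last_fun_eq(1)[OF f] t assms(4) by simp
qed

text \<open>The vertices of the cube have \<open>a\<close>-coordinates 0, \<open>t\<close>, 1 and
  \<open>t + 1\<close>; each nonzero one, combined with \<open>s\<close>, leaves \<open>s^2\<close>
  divided by it. Excluding \<open>t = 0\<close> and \<open>t = 1\<close> keeps these denominators
  nonzero.\<close>

lemma third_diff_g_last:
  assumes f: "is_g_function m f (g_last m)" and "s \<in> F" "t \<in> F" "t \<noteq> 0" "t \<noteq> 1"
  shows "third_diff f 0 s (t * a) a = tr (s\<^sup>2 * (1 / t + 1 + 1 / (t + 1)))"
proof -
  note c = g_last_coordinates[OF f]
  have t1: "t + 1 \<in> F" "t + 1 \<noteq> 0" using assms F_add F_1 by (auto simp: add_eq_0_char2)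
  have F: "f 0 = 0" "f s = tr s"
    using g_last_fun_eq(2)[OF f] assms F_0 tr_0 by auto
  have 1: "f (t * a) = tr (t * (1 + N a))" "f a = tr (1 * (1 + N a))"
      "f (t * a + a) = tr ((t + 1) * (1 + N a))"
    using c[OF F_0 assms(3,4)] c[OF F_0 F_1] c[OF F_0 t1] by (simp_all add: distrib_right)
  have 2: "f (s + t * a) = tr (s\<^sup>2 / t + s + t * (1 + N a))"
      "f (s + a) = tr (s\<^sup>2 / 1 + s + 1 * (1 + N a))"
      "f (s + t * a + a) = tr (s\<^sup>2 / (t + 1) + s + (t + 1) * (1 + N a))"
    using c[OF assms(2-4)] c[OF assms(2) F_1] c[OF assms(2) t1] by (simp_all add: distrib_right add.assoc)
  show ?thesis
    unfolding third_diff_def add_0 F 1 2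
    by (simp add: tr_add distrib_left distrib_right ac_simps)
qed

lemma f_one_g_last_not_equiv:
  assumes f: "is_g_function m f (g_last m)"
  shows "(f_one m a, f) \<notin> boolean_equiv"
proof
  assume eq: "(f_one m a, f) \<in> boolean_equiv"
  have "f_one m a = (\<lambda>x. tr (N x))" using f_one_eq by blast
  hence D: "third_diff f 0 x y z = 0" for x y z
    using third_diff_boolean_equiv[OF eq] third_diff_tr_N by simp
  have root: "t ^ 4 + t = 0" if t: "t \<in> F" for t
  proof (cases "t = 0 \<or> t = 1")
    case False
    let ?c = "1 / t + 1 + 1 / (t + 1)"
    have t1: "t + 1 \<noteq> 0" using False by (simp add: add_eq_0_char2)
    \<comment> \<open>As \<open>s\<close> runs through \<open>F\<close> so does \<open>s^2\<close>,
      so the third differences test \<open>?c\<close> against all of \<open>F\<close>.\<close>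
    have "tr (l * ?c) = 0" if "l \<in> F" for l
    proof -
      obtain s where "s \<in> F" "s\<^sup>2 = l" using F_sqrt \<open>l \<in> F\<close> by blast
      thus ?thesis using D third_diff_g_last[OF f _ t, of s] False by auto
    qed
    moreover have "?c \<in> F" using t by (intro F_closed)
    ultimately have "?c = 0" by (rule tr_nondegenerate)
    \<comment> \<open>Denominators are cleared with an atom \<open>w\<close> in place of
      \<open>t + 1\<close>, which is expanded only after instantiation.\<close>
    moreover have "(t * w)\<^sup>2 * (1 / t + 1 + 1 / w) = t * w\<^sup>2 + t\<^sup>2 * w\<^sup>2 + t\<^sup>2 * w" if "w \<noteq> 0" for w
      using False that by (simp add: distrib_left power2_eq_square)
    from this[OF t1] have "(t * (t + 1))\<^sup>2 * ?c = t ^ 4 + t"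
      by (simp add: distrib_left distrib_right power2_eq_square power4_eq_xxxx ac_simps)
    ultimately show ?thesis by simp
  qed auto
  \<comment> \<open>\<open>X ^ 4 + X\<close> has at most four roots, while \<open>F\<close> has at
    least eight elements.\<close>
  let ?p = "[:0, 1, 0, 0, 1:] :: 'k poly"
  have "card F \<le> degree ?p"
    by (rule card_roots_le) (use root in \<open>auto simp: power4_eq_xxxx algebra_simps\<close>)
  thus False using card_F q_ge_8 by simp
qed

end

section \<open>The g-function of the Niho power sum\<close>

lemma power_cong_exponent:
  fixes x :: 'k
  assumes "[j = k] (mod 2 ^ (2 * m) - 1)" "x \<noteq> 0"
  shows "x ^ j = x ^ k"
proof -
  let ?n = "2 ^ (2 * m) - 1 :: nat"
  have "x * x ^ ?n = x"
    using power_card_eq_same[of x] unfolding card_K by (subst (asm) power_eq_if) simp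
  hence "x ^ ?n = 1" using assms(2) by simp
  hence "x ^ (?n * (e div ?n) + e mod ?n) = x ^ (e mod ?n)" for e
    by (simp only: power_add power_mult power_one mult_1_left)
  hence "x ^ e = x ^ (e mod ?n)" for e by (simp only: mult_div_mod_eq)
  from this[of j] this[of k] show ?thesis using assms(1) by (simp only: cong_def)
qed

text \<open>With \<open>h = 2 ^ (m - 1)\<close>, raising to \<open>h\<close> is injective and makes
  the congruence applicable. Then \<open>l ^ (2 ^ m - 1) = 1\<close> and
  \<open>u ^ (2 ^ m - 1) = (cj u)^2\<close>, while
  \<open>(u ^ (4 * i)) ^ h = (cj u) ^ (2 * i)\<close> because
  \<open>4 * h = 2 * 2 ^ m\<close>.\<close>

lemma niho_power:
  assumes d: "[2 ^ (m - 1) * d = (2 ^ m - 1) * i + 2 ^ (m - 1)] (mod 2 ^ (2 * m) - 1)"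
    and "l \<in> F" "u \<in> S"
  shows "(l * u) ^ d = l * u ^ (1 + 4 * i)"
proof (cases "l = 0")
  case True
  \<comment> \<open>As \<open>0 ^ 0 = 1\<close>, a zero exponent must be excluded; it would make
    \<open>2 ^ m - 1\<close> divide \<open>2 ^ (m - 1)\<close>.\<close>
  have "d \<noteq> 0"
  proof
    assume "d = 0"
    hence "2 ^ (2 * m) - 1 dvd (2 ^ m - 1) * i + (2 :: nat) ^ (m - 1)"
      using d by (simp add: cong_def mod_eq_0_iff_dvd)
    moreover have "(2::nat) ^ (2 * m) - 1 = (2 ^ m - 1) * (2 ^ m + 1)"
      by (simp only: mult_2 power_add) (simp add: algebra_simps)
    ultimately have "2 ^ m - 1 dvd (2 ^ m - 1) * i + (2 :: nat) ^ (m - 1)"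
      by (metis dvd_mult_left)
    hence "2 ^ m - 1 dvd (2 :: nat) ^ (m - 1)" by (simp add: dvd_add_right_iff)
    hence "2 ^ m - 1 \<le> (2 :: nat) ^ (m - 1)" by (rule dvd_imp_le) simp
    moreover have "(2::nat) ^ m = 2 * 2 ^ (m - 1)" using m_ge by (simp flip: power_Suc)
    ultimately show False using q_ge_8 by linarith
  qed
  thus ?thesis using True by simp
next
  case False
  let ?h = "2 ^ (m - 1) :: nat"
  have q: "2 * ?h = 2 ^ m" using m_ge by (simp flip: power_Suc)
  have u0: "u \<noteq> 0" using assms S_nz by blast
  have "l * l ^ (2 ^ m - 1) = l"
    using assms(2) by (subst power_Suc [symmetric]) (simp add: subF_def)
  hence lq: "l ^ (2 ^ m - 1) = 1" using False by simp
  have "u * u ^ (2 ^ m - 1) = cj u"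
    by (subst power_Suc [symmetric]) (simp add: conj_q_def)
  also have "\<dots> = u * (cj u)\<^sup>2"
    using assms(3) by (simp add: S_iff power2_eq_square flip: mult.assoc)
  finally have uq: "u ^ (2 ^ m - 1) = (cj u)\<^sup>2" using u0 by simp
  have "((l * u) ^ d) ^ ?h = (l * u) ^ (?h * d)" by (simp add: mult.commute flip: power_mult)
  also have "\<dots> = (l * u) ^ ((2 ^ m - 1) * i + ?h)"
    using d by (rule power_cong_exponent) (use False u0 in simp)
  also have "\<dots> = ((cj u)\<^sup>2) ^ i * (l * u) ^ ?h"
    by (simp add: power_add power_mult power_mult_distrib lq [simplified] uq [simplified])
  also have "((cj u)\<^sup>2) ^ i = (u ^ (4 * i)) ^ ?h"
  proof -
    have "(u ^ (4 * i)) ^ ?h = u ^ (2 ^ m * (2 * i))"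
      unfolding q [symmetric] by (simp add: ac_simps flip: power_mult)
    thus ?thesis by (simp add: power_mult conj_q_def)
  qed
  also have "\<dots> * (l * u) ^ ?h = (l * u ^ (1 + 4 * i)) ^ ?h"
    by (simp add: power_mult_distrib ac_simps)
  finally show ?thesis by (simp only: frob_inj)
qed

text \<open>For \<open>u \<noteq> 1\<close> put \<open>y = u + 1\<close>. The geometric series of
  ratio \<open>u ^ 4\<close> closes up at \<open>u ^ (2 ^ m) = cj u\<close>: taken from
  \<open>i = 0\<close> it has denominator \<open>y ^ 4\<close> and numerator
  \<open>u * (cj u + 1) = y\<close>, hence sum \<open>1 / y ^ 3\<close>. Then
  \<open>T u = y^2 / u\<close> gives \<open>1 + T (1 / y ^ 3) = 1 / T u\<close>.\<close>

lemma g_last_sum: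
  assumes "u \<in> S"
  shows "g_last m u = 1 + (\<Sum>i = 1..2 ^ (m - 2) - 1. T (u ^ (1 + 4 * i)))"
proof (cases "u = 1")
  case True
  thus ?thesis by (simp add: g_last_def cj_1)
next
  case False
  let ?M = "2 ^ (m - 2) :: nat"
  define y where "y = u + 1"
  define P where "P = (\<Sum>i<?M. u ^ (1 + 4 * i))"
  have y0: "y \<noteq> 0" and u0: "u \<noteq> 0" using False S_nz assms by (auto simp: y_def add_eq_0_char2)
  have uy: "u = y + 1" by (simp add: y_def add.assoc)
  have geo: "(u ^ 4 + 1) * (\<Sum>i<n. u ^ (1 + 4 * i)) = u * (u ^ (4 * n) + 1)" for n
    by (induction n) (simp_all add: algebra_simps power_add)
  have M: "4 * ?M = 2 ^ m"
  proof -
    have "m = Suc (Suc (m - 2))" using m_ge by simp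
    hence "(2::nat) ^ m = 2 ^ Suc (Suc (m - 2))" by (rule arg_cong)
    thus ?thesis by simp
  qed
  have "y ^ 4 * P = u * (cj u + 1)"
    using geo[of ?M] frob_add[of u 1 2] unfolding M by (simp add: P_def y_def conj_q_def)
  also have "\<dots> = y" using assms by (simp add: S_iff y_def distrib_left add.commute)
  finally have "y * (y ^ 3 * P) = y * 1" by (simp add: power4_eq_xxxx power3_eq_cube mult.assoc)
  hence P: "P = 1 / y ^ 3" using y0 by (simp add: field_simps)
  have cy: "cj y = y / u" using assms u0 by (simp add: y_def cj_simps S_cj field_simps)
  have Tu: "T u = y\<^sup>2 / u"
    using assms u0 by (simp add: y_def S_cj field_simps power2_eq_square)
  have "(\<Sum>i = 1..?M - 1. T (u ^ (1 + 4 * i))) = T (\<Sum>i = 1..?M - 1. u ^ (1 + 4 * i))"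
    by (simp add: sum.distrib cj_sum)
  \<comment> \<open>The sum omits the term \<open>u\<close> of \<open>i = 0\<close>; compensating
    for it produces the summand \<open>T u\<close>.\<close>
  also have "(\<Sum>i = 1..?M - 1. u ^ (1 + 4 * i)) = P + u"
  proof -
    have "{..<?M} = insert 0 {1..?M - 1}" by auto
    thus ?thesis by (simp add: P_def ac_simps)
  qed
  finally have "1 + (\<Sum>i = 1..?M - 1. T (u ^ (1 + 4 * i))) = (1 + T P) + T u"
    by (simp only: T_add) (simp only: add.assoc)
  also have "1 + T P = 1 / T u"
  proof -
    have "y ^ 3 * (1 + T P) = y ^ 3 + 1 + u ^ 3"
      using y0 u0 by (simp add: P cj_simps cy distrib_left power_divide add.assoc)
    also have "\<dots> = u * y"
      unfolding uy by (simp add: power3_eq_cube distrib_left distrib_right ac_simps)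
    also have "\<dots> = y ^ 3 * (1 / T u)"
      using y0 u0 by (simp add: Tu power2_eq_square power3_eq_cube)
    finally show ?thesis using y0 by (simp only: mult_cancel_left power_not_zero simp_thms)
  qed
  finally show ?thesis using g_last_eq[OF assms False] by (simp add: add.commute)
qed

lemma is_g_function_f_niho:
  assumes Ta: "T a = 1" and d: "niho_exponents m (m - 1) d"
  shows "is_g_function m (f_niho m (m - 1) d a) (g_last m)"
  unfolding is_g_function_def
proof (intro conjI ballI)
  fix l u assume lu: "l \<in> F" "u \<in> S"
  let ?I = "{1..2 ^ (m - 1 - 1) - 1 :: nat}"
  have "trK m (\<Sum>i\<in>?I. (l * u) ^ d i) = tr (\<Sum>i\<in>?I. T ((l * u) ^ d i))"
    by (simp add: trK_eq cj_sum sum.distrib)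
  also have "(\<Sum>i\<in>?I. T ((l * u) ^ d i)) = (\<Sum>i\<in>?I. l * T (u ^ (1 + 4 * i)))"
  proof (rule sum.cong)
    fix i assume "i \<in> ?I"
    hence "(l * u) ^ d i = l * u ^ (1 + 4 * i)"
      using d lu unfolding niho_exponents_def by (intro niho_power) auto
    thus "T ((l * u) ^ d i) = l * T (u ^ (1 + 4 * i))" by (simp only: T_scale lu)
  qed simp
  also have "\<dots> = l * (\<Sum>i\<in>?I. T (u ^ (1 + 4 * i)))" by (rule sum_distrib_left [symmetric])
  finally have sum: "trK m (\<Sum>i\<in>?I. (l * u) ^ d i) = tr (l * (\<Sum>i\<in>?I. T (u ^ (1 + 4 * i))))" .
  have "f_one m a (l * u) = tr l"
    using lu by (simp add: f_one_eq[OF Ta] N_polar tr_sq)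
  hence "f_niho m (m - 1) d a (l * u) = tr l + tr (l * (\<Sum>i\<in>?I. T (u ^ (1 + 4 * i))))"
    by (simp only: f_niho_def f_one_def trK_add sum)
  also have "?I = {1..2 ^ (m - 2) - 1}" by (simp add: numeral_2_eq_2)
  finally show "f_niho m (m - 1) d a (l * u) = tr (l * g_last m u)"
    using lu by (simp only: g_last_sum distrib_left tr_add mult_1_right)
qed (rule g_last_F)

section \<open>Counting the classes\<close>

lemma niho_bent_hyperconic_classes:
  fixes f1 fl :: "'k \<Rightarrow> 'k"
  assumes f1: "is_g_function m f1 (\<lambda>u. 1)" and fl: "is_g_function m fl (g_last m)"
    and neq: "(f1, fl) \<notin> boolean_equiv"
  shows "card (niho_bent_assoc m (hyperconic m :: ('k \<times> 'k) set set) // boolean_equiv) = 2"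
proof -
  let ?c = "\<lambda>f. boolean_equiv `` {f :: 'k \<Rightarrow> 'k}"
  let ?A = "niho_bent_assoc m (hyperconic m :: ('k \<times> 'k) set set)"
  have eq: "?c f = ?c f'" if "(f, f') \<in> boolean_equiv" for f f'
    using equiv_class_eq[OF equiv_boolean_equiv that] .
  have "?A // boolean_equiv = {?c f1, ?c fl}"
  proof (intro equalityI subsetI)
    fix X assume "X \<in> ?A // boolean_equiv"
    then obtain f where "f \<in> ?A" "X = ?c f" by (auto simp: quotient_def)
    thus "X \<in> {?c f1, ?c fl}" using niho_bent_hyperconic_cases[OF _ f1 fl] eq by blast
  next
    fix X assume "X \<in> {?c f1, ?c fl}"
    thus "X \<in> ?A // boolean_equiv"
      using niho_bent_assoc_one[OF f1] niho_bent_assoc_g_last[OF fl] by (auto simp: quotient_def)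
  qed
  moreover have "?c f1 \<noteq> ?c fl"
    using neq eq_equiv_class[OF _ equiv_boolean_equiv] boolean_fun_niho[OF fl] by auto
  ultimately show ?thesis by simp
qed

end

theorem theorem4p2:
  fixes m :: nat and a :: "'k::{field,finite}" and d :: "nat \<Rightarrow> nat"
  assumes "m \<ge> 3"
    and "CARD('k) = 2 ^ (2 * m)"
    and "a + conj_q m a = 1"
    and "niho_exponents m (m - 1) d"
  shows "card (niho_bent_assoc m (hyperconic m :: ('k \<times> 'k) set set) // boolean_equiv) = 2
    \<and> f_one m a \<in> niho_bent_assoc m (hyperconic m)
    \<and> f_niho m (m - 1) d a \<in> niho_bent_assoc m (hyperconic m)
    \<and> (f_one m a, f_niho m (m - 1) d a) \<notin> boolean_equiv
    \<and> is_g_function m (f_one m a) (\<lambda>u. 1)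
    \<and> is_g_function m (f_niho m (m - 1) d a) (g_last m)"
proof -
  interpret niho_field m "TYPE('k)"
    using assms(1,2) by unfold_locales
  have f1: "is_g_function m (f_one m a) (\<lambda>u. 1)"
    using assms(3) by (rule is_g_function_f_one)
  have fl: "is_g_function m (f_niho m (m - 1) d a) (g_last m)"
    using assms(3,4) by (rule is_g_function_f_niho)
  have neq: "(f_one m a, f_niho m (m - 1) d a) \<notin> boolean_equiv"
    using assms(3) fl by (rule f_one_g_last_not_equiv)
  show ?thesis
    using niho_bent_hyperconic_classes[OF f1 fl neq] niho_bent_assoc_one[OF f1]
      niho_bent_assoc_g_last[OF fl] neq f1 fl by blast
qed

end
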